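(* Let $B$ be a supersoluble brace such that $(B,+)$ has no non-zero element of finite odd order. Then $|B/\operatorname{Fit}(B)|$ is a power of $2$.
   Context: A brace (skew left brace) is a set $B$ with two binary operations $+$ and $\cdot$ such that $(B,+)$ and $(B,\cdot)$ are groups and $a(b+c)=ab-a+ac$ for all $a,b,c\in B$. $\lambda_a(b)=-a+ab$ defines a homomorphism $\lambda\colon(B,\cdot)\to\operatorname{Aut}(B,+)$. An ideal is a subset that is a subgroup of both groups, normal in both, and invariant under all $\lambda_b$; quotients by ideals are braces. $\operatorname{Soc}(B)=\operatorname{Ker}\lambda\cap Z(B,+)$ and $\zeta(B)=\operatorname{Soc}(B)\cap Z(B,\cdot)$. An ideal $I$ of $B$ is $B$-centrally nilpotent if there is a finite chain $\{0\}=I_0\le\dots\le I_n=I$ of ideals of $B$ with $I_{i+1}/I_i\le\zeta(I/I_i)$ for all $i$. $\operatorname{Fit}(B)$ is the sum of all $B$-centrally nilpotent ideals of $B$. $B$ is supersoluble if there is a finite chain of ideals $\{0\}=J_0\le\dots\le J_n=B$ such that for each $i$, either $(J_{i+1}/J_i,+)$ is infinite cyclic and $J_{i+1}/J_i\le\operatorname{Soc}(B/J_i)$, or $J_{i+1}/J_i$ has prime order. (The hypothesis is written in the paper as $U_2^+(B)=\{0\}$, where $U_2^+(B)$ is the set of odd-order elements of $(B,+)$.) *)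

theory Defs
  imports "HOL-Algebra.Algebra" "HOL-Computational_Algebra.Primes"
begin

text \<open>A (skew left) brace is given by two group structures A = (B,+) and M = (B,\<cdot>)
  on the same carrier B, written in HOL-Algebra notation (the group operation of A is
  the brace addition, that of M the brace multiplication).\<close>

definition brace :: "'a monoid \<Rightarrow> 'a monoid \<Rightarrow> bool" where
  "brace A M \<longleftrightarrow> group A \<and> group M \<and> carrier A = carrier M \<and>
     (\<forall>a\<in>carrier A. \<forall>b\<in>carrier A. \<forall>c\<in>carrier A.
        a \<otimes>\<^bsub>M\<^esub> (b \<otimes>\<^bsub>A\<^esub> c)
          = (a \<otimes>\<^bsub>M\<^esub> b) \<otimes>\<^bsub>A\<^esub> inv\<^bsub>A\<^esub> a \<otimes>\<^bsub>A\<^esub> (a \<otimes>\<^bsub>M\<^esub> c))"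

definition blambda :: "'a monoid \<Rightarrow> 'a monoid \<Rightarrow> 'a \<Rightarrow> 'a \<Rightarrow> 'a" where
  "blambda A M a b = inv\<^bsub>A\<^esub> a \<otimes>\<^bsub>A\<^esub> (a \<otimes>\<^bsub>M\<^esub> b)"

definition brace_ideal :: "'a monoid \<Rightarrow> 'a monoid \<Rightarrow> 'a set \<Rightarrow> bool" where
  "brace_ideal A M I \<longleftrightarrow> I \<subseteq> carrier A \<and> subgroup I A \<and> subgroup I M \<and>
     I \<lhd> A \<and> I \<lhd> M \<and> (\<forall>b\<in>carrier A. \<forall>x\<in>I. blambda A M b x \<in> I)"

definition Soc :: "'a monoid \<Rightarrow> 'a monoid \<Rightarrow> 'a set" where
  "Soc A M = {a \<in> carrier A. (\<forall>b\<in>carrier A. blambda A M a b = b) \<and>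
                              (\<forall>b\<in>carrier A. a \<otimes>\<^bsub>A\<^esub> b = b \<otimes>\<^bsub>A\<^esub> a)}"

definition bzeta :: "'a monoid \<Rightarrow> 'a monoid \<Rightarrow> 'a set" where
  "bzeta A M = {a \<in> Soc A M. \<forall>b\<in>carrier M. a \<otimes>\<^bsub>M\<^esub> b = b \<otimes>\<^bsub>M\<^esub> a}"

text \<open>The quotient brace B/I is (A Mod I, M Mod I); for an ideal I the additive and
  multiplicative cosets coincide.  The subbrace given by an ideal I is obtained by
  restricting both carriers to I.  For ideals J \<subseteq> K, the subset K/J of B/J is the
  set of cosets of J with representatives in K.\<close>

definition quot_set :: "'a monoid \<Rightarrow> 'a set \<Rightarrow> 'a set \<Rightarrow> 'a set set" where
  "quot_set A K J = carrier (A\<lparr>carrier := K\<rparr> Mod J)"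

definition B_centrally_nilpotent :: "'a monoid \<Rightarrow> 'a monoid \<Rightarrow> 'a set \<Rightarrow> bool" where
  "B_centrally_nilpotent A M I \<longleftrightarrow> brace_ideal A M I \<and>
     (\<exists>(C::nat \<Rightarrow> 'a set) n. C 0 = {\<one>\<^bsub>A\<^esub>} \<and> C n = I \<and>
        (\<forall>k\<le>n. brace_ideal A M (C k)) \<and>
        (\<forall>k<n. C k \<subseteq> C (Suc k) \<and>
           quot_set A (C (Suc k)) (C k)
             \<subseteq> bzeta (A\<lparr>carrier := I\<rparr> Mod C k) (M\<lparr>carrier := I\<rparr> Mod C k)))"

definition Fit :: "'a monoid \<Rightarrow> 'a monoid \<Rightarrow> 'a set" where
  "Fit A M = generate A (\<Union>{I. brace_ideal A M I \<and> B_centrally_nilpotent A M I})"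

definition supersoluble_brace :: "'a monoid \<Rightarrow> 'a monoid \<Rightarrow> bool" where
  "supersoluble_brace A M \<longleftrightarrow>
     (\<exists>(J::nat \<Rightarrow> 'a set) n. J 0 = {\<one>\<^bsub>A\<^esub>} \<and> J n = carrier A \<and>
        (\<forall>k\<le>n. brace_ideal A M (J k)) \<and>
        (\<forall>k<n. J k \<subseteq> J (Suc k) \<and>
           ((cyclic_group (A\<lparr>carrier := J (Suc k)\<rparr> Mod J k) \<and>
             infinite (quot_set A (J (Suc k)) (J k)) \<and>
             quot_set A (J (Suc k)) (J k) \<subseteq> Soc (A Mod J k) (M Mod J k))
            \<or> Factorial_Ring.prime (card (quot_set A (J (Suc k)) (J k))))))"

end

(* Modulo an ideal of 2-power index the odd prime factors of a supersoluble series of B become trivial, and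
  factors of order 2 are always central.  Two points remain.

  (1) Separation: if no odd multiple of x lies in an ideal I0, then some ideal of 2-power index contains I0
  but not x.  Take I maximal among the ideals above I0 containing no odd multiple of x, and climb along the
  series of B.  If the climb from I first meets a factor that is not of order 2, that factor (infinite, or
  cyclic of odd order) can be moved down past the factors of order 2 by passing to doubles, which gives an
  ideal just above I contradicting the maximality.

  (2) If J'/J is an infinite factor of the series with generator g, separating 2g from J + 4J' gives an ideal
  of 2-power index all of whose elements act on J'/J as 1 and not as -1.

  Let N be the intersection of the ideals from (2).  Intersecting N with the closures of the terms J_k, i.e.
  with all J_k + I for I of 2-power index, gives a B-central series of N; its bottom term is 0 by (1) since
  there is no odd torsion.  Hence N lies in Fit B and |B/Fit B| divides |B/N|. *)

theory Submission
  imports Defs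
begin

subsection \<open>Ideals of a brace\<close>

text \<open>The comments write A additively, so \<open>x [^] k\<close> is kx. Doubling moves a
  cyclic factor L/T below a factor T/U of order 2 because T/U is central of exponent 2: defects with
  values in T/U vanish on doubled elements. For an infinite L/T these defects are the commutators
  and the action of L, which are trivial modulo T by the socle condition. For an odd L/T no such
  condition is available, and multiplicative squares in L take over the role of doubles. Maximality
  in (1) is among ideals avoiding all odd multiples of x, because avoiding x alone would not exclude
  an odd factor just above I that contains x. In (2) the constant 4 is chosen so that no odd
  multiple of 2g lies in J + 4J', while an element of I acting as -1 would force 2g into I. The
  terms J_k are replaced by their closures because a factor of odd order need not be central; it
  becomes trivial once an ideal of 2-power index is added.\<close>

locale skew_brace = group A + M: group M
  for A :: "'a monoid" (structure) and M :: "'a monoid" +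
  assumes carrier_mult [simp]: "carrier M = carrier A"
    and brace_distrib: "\<lbrakk>a \<in> carrier A; b \<in> carrier A; c \<in> carrier A\<rbrakk> \<Longrightarrow>
      a \<otimes>\<^bsub>M\<^esub> (b \<otimes> c) = (a \<otimes>\<^bsub>M\<^esub> b) \<otimes> inv a \<otimes> (a \<otimes>\<^bsub>M\<^esub> c)"

lemma brace_iff_skew_brace: "brace A M \<longleftrightarrow> skew_brace A M"
  by (auto simp: brace_def skew_brace_def skew_brace_axioms_def)

context skew_brace
begin

abbreviation lam :: "'a \<Rightarrow> 'a \<Rightarrow> 'a" where "lam \<equiv> blambda A M"

section \<open>Arithmetic of the lambda map\<close>

lemma mult_closed [simp, intro]:
  "\<lbrakk>a \<in> carrier A; b \<in> carrier A\<rbrakk> \<Longrightarrow> a \<otimes>\<^bsub>M\<^esub> b \<in> carrier A"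
  using M.m_closed by simp

lemma minv_closed [simp, intro]: "a \<in> carrier A \<Longrightarrow> inv\<^bsub>M\<^esub> a \<in> carrier A"
  using M.inv_closed by simp

lemma lam_closed [simp, intro]:
  "\<lbrakk>a \<in> carrier A; b \<in> carrier A\<rbrakk> \<Longrightarrow> lam a b \<in> carrier A"
  by (simp add: blambda_def)

lemma mult_conv_lam:
  "\<lbrakk>a \<in> carrier A; b \<in> carrier A\<rbrakk> \<Longrightarrow> a \<otimes>\<^bsub>M\<^esub> b = a \<otimes> lam a b"
  by (simp add: blambda_def m_assoc [symmetric])

lemma lam_add:
  "\<lbrakk>a \<in> carrier A; b \<in> carrier A; c \<in> carrier A\<rbrakk> \<Longrightarrow> lam a (b \<otimes> c) = lam a b \<otimes> lam a c"
  by (simp add: blambda_def brace_distrib m_assoc)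

lemma lam_mult:
  assumes "a \<in> carrier A" "b \<in> carrier A" "c \<in> carrier A"
  shows "lam (a \<otimes>\<^bsub>M\<^esub> b) c = lam a (lam b c)"
proof -
  have "(a \<otimes>\<^bsub>M\<^esub> b) \<otimes>\<^bsub>M\<^esub> c = a \<otimes>\<^bsub>M\<^esub> (b \<otimes>\<^bsub>M\<^esub> c)"
    using assms by (simp add: M.m_assoc)
  then have "(a \<otimes>\<^bsub>M\<^esub> b) \<otimes> lam (a \<otimes>\<^bsub>M\<^esub> b) c = a \<otimes> lam a (b \<otimes> lam b c)"
    using assms by (simp add: mult_conv_lam)
  also have "\<dots> = (a \<otimes>\<^bsub>M\<^esub> b) \<otimes> lam a (lam b c)"
    using assms by (simp add: lam_add mult_conv_lam m_assoc)
  finally show ?thesis using assms by simp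
qed

text \<open>The distributive law at zero makes zero a multiplicative idempotent, and the only
  idempotent of a group is its identity.\<close>

lemma mult_one [simp]: "\<one>\<^bsub>M\<^esub> = \<one>"
proof -
  have "\<one> \<otimes>\<^bsub>M\<^esub> (\<one> \<otimes> \<one>) = (\<one> \<otimes>\<^bsub>M\<^esub> \<one>) \<otimes> inv \<one> \<otimes> (\<one> \<otimes>\<^bsub>M\<^esub> \<one>)"
    by (rule brace_distrib) auto
  then have "\<one> \<otimes>\<^bsub>M\<^esub> \<one> = (\<one> \<otimes>\<^bsub>M\<^esub> \<one>) \<otimes> (\<one> \<otimes>\<^bsub>M\<^esub> \<one>)"
    by (metis inv_one mult_closed one_closed r_one)
  then have "\<one> \<otimes>\<^bsub>M\<^esub> \<one> = \<one>" by (metis l_cancel_one' mult_closed one_closed)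
  then have "\<one> \<otimes>\<^bsub>M\<^esub> \<one> = \<one> \<otimes>\<^bsub>M\<^esub> \<one>\<^bsub>M\<^esub>" using M.r_one [of \<one>] by simp
  then show ?thesis using M.l_cancel [of \<one> \<one> "\<one>\<^bsub>M\<^esub>"] M.one_closed by simp
qed

lemma mult_one_right [simp]: "a \<in> carrier A \<Longrightarrow> a \<otimes>\<^bsub>M\<^esub> \<one> = a"
  using M.r_one [of a] by (simp del: M.r_one)

lemma group_hom_lam: "a \<in> carrier A \<Longrightarrow> group_hom A A (lam a)"
  by unfold_locales (auto simp: hom_def lam_add)

lemma lam_one_right [simp]: "a \<in> carrier A \<Longrightarrow> lam a \<one> = \<one>"
  by (rule group_hom.hom_one [OF group_hom_lam])

lemma lam_int_pow:
  "\<lbrakk>a \<in> carrier A; b \<in> carrier A\<rbrakk> \<Longrightarrow> lam a (b [^] (k::int)) = lam a b [^] k"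
  by (rule group_hom.hom_int_pow [OF group_hom_lam])

lemma lam_one_left [simp]: "b \<in> carrier A \<Longrightarrow> lam \<one> b = b"
  using M.l_one [of b] by (simp add: blambda_def)

lemma lam_minv_left [simp]:
  "\<lbrakk>a \<in> carrier A; b \<in> carrier A\<rbrakk> \<Longrightarrow> lam (inv\<^bsub>M\<^esub> a) (lam a b) = b"
  using lam_mult [of "inv\<^bsub>M\<^esub> a" a b] M.l_inv [of a] by simp

lemma lam_minv_right [simp]:
  "\<lbrakk>a \<in> carrier A; b \<in> carrier A\<rbrakk> \<Longrightarrow> lam a (lam (inv\<^bsub>M\<^esub> a) b) = b"
  using lam_mult [of a "inv\<^bsub>M\<^esub> a" b] M.r_inv [of a] by simp

lemma add_conv_mult:
  "\<lbrakk>a \<in> carrier A; b \<in> carrier A\<rbrakk> \<Longrightarrow> a \<otimes> b = a \<otimes>\<^bsub>M\<^esub> lam (inv\<^bsub>M\<^esub> a) b"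
  by (simp add: mult_conv_lam)

lemma minv_conv: "a \<in> carrier A \<Longrightarrow> inv\<^bsub>M\<^esub> a = inv (lam (inv\<^bsub>M\<^esub> a) a)"
  using mult_conv_lam [of "inv\<^bsub>M\<^esub> a" a] M.l_inv [of a]
  by (metis inv_equality inv_closed inv_inv lam_closed minv_closed carrier_mult mult_one inv_comm)

text \<open>Multiplicative normality is awkward to check for constructed sets. Since xb = x + (lam x
  b - b) + b, the condition \<open>starI\<close> puts xb into I + b = b + I, and b + I is the
  multiplicative coset bI by invariance under \<open>lam\<close>. The converse is
  \<open>ideal_star\<close>.\<close>

lemma idealI:
  assumes sub: "subgroup I A"
    and norm: "\<And>b x. \<lbrakk>b \<in> carrier A; x \<in> I\<rbrakk> \<Longrightarrow> b \<otimes> x \<otimes> inv b \<in> I"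
    and lamI: "\<And>b x. \<lbrakk>b \<in> carrier A; x \<in> I\<rbrakk> \<Longrightarrow> lam b x \<in> I"
    and starI: "\<And>b x. \<lbrakk>b \<in> carrier A; x \<in> I\<rbrakk> \<Longrightarrow> lam x b \<otimes> inv b \<in> I"
  shows "brace_ideal A M I"
proof -
  interpret I: subgroup I A by fact
  have nA: "I \<lhd> A" using sub norm by (simp add: normal_inv_iff)
  have subM: "subgroup I M"
  proof
    show "I \<subseteq> carrier M" using I.subset by simp
    show "x \<otimes>\<^bsub>M\<^esub> y \<in> I" if "x \<in> I" "y \<in> I" for x y
      using that lamI by (simp add: mult_conv_lam)
    show "\<one>\<^bsub>M\<^esub> \<in> I" by simp
    show "inv\<^bsub>M\<^esub> x \<in> I" if "x \<in> I" for x
    proof -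
      have "lam (inv\<^bsub>M\<^esub> x) x \<in> I" using that lamI by simp
      then show ?thesis using that by (subst minv_conv) auto
    qed
  qed
  have nM0: "inv\<^bsub>M\<^esub> b \<otimes>\<^bsub>M\<^esub> (x \<otimes>\<^bsub>M\<^esub> b) \<in> I" if b: "b \<in> carrier A" and x: "x \<in> I" for b x
  proof -
    define i where "i = inv b \<otimes> (x \<otimes>\<^bsub>M\<^esub> b)"
    have xc: "x \<in> carrier A" using x by simp
    have ic: "i \<in> carrier A" using b xc by (simp add: i_def)
    have "x \<otimes>\<^bsub>M\<^esub> b = (x \<otimes> (lam x b \<otimes> inv b)) \<otimes> b"
      using b xc by (simp add: mult_conv_lam m_assoc)
    then have "i = inv b \<otimes> (x \<otimes> (lam x b \<otimes> inv b)) \<otimes> inv (inv b)"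
      using b xc by (simp add: i_def m_assoc)
    then have "i \<in> I" using norm [of "inv b" "x \<otimes> (lam x b \<otimes> inv b)"] b x starI by simp
    then have l: "lam (inv\<^bsub>M\<^esub> b) i \<in> I" using lamI b by simp
    have "x \<otimes>\<^bsub>M\<^esub> b = b \<otimes> i" using b xc by (simp add: i_def m_assoc [symmetric])
    also have "\<dots> = b \<otimes>\<^bsub>M\<^esub> lam (inv\<^bsub>M\<^esub> b) i" using b ic by (rule add_conv_mult)
    finally show ?thesis using l b ic
      by (metis I.mem_carrier M.inv_solve_left carrier_mult lam_closed minv_closed mult_closed)
  qed
  have nM: "I \<lhd> M"
  proof -
    have "b \<otimes>\<^bsub>M\<^esub> x \<otimes>\<^bsub>M\<^esub> inv\<^bsub>M\<^esub> b \<in> I" if "b \<in> carrier A" "x \<in> I" for b x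
      using nM0 [of "inv\<^bsub>M\<^esub> b" x] that M.inv_inv [of b] by (simp add: M.m_assoc)
    then show ?thesis using subM by (simp add: M.normal_inv_iff)
  qed
  show ?thesis using sub subM nA nM lamI I.subset unfolding brace_ideal_def by blast
qed

lemma ideal_subset: "brace_ideal A M I \<Longrightarrow> I \<subseteq> carrier A"
  and ideal_subgroup: "brace_ideal A M I \<Longrightarrow> subgroup I A"
  and ideal_normal: "brace_ideal A M I \<Longrightarrow> I \<lhd> A"
  and ideal_normal_mult: "brace_ideal A M I \<Longrightarrow> I \<lhd> M"
  and ideal_lam: "\<lbrakk>brace_ideal A M I; b \<in> carrier A; x \<in> I\<rbrakk> \<Longrightarrow> lam b x \<in> I"
  by (auto simp: brace_ideal_def)

lemma ideal_mem: "\<lbrakk>brace_ideal A M I; x \<in> I\<rbrakk> \<Longrightarrow> x \<in> carrier A"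
  using ideal_subset by blast

lemma ideal_conj:
  "\<lbrakk>brace_ideal A M I; b \<in> carrier A; x \<in> I\<rbrakk> \<Longrightarrow> b \<otimes> x \<otimes> inv b \<in> I"
  by (auto dest!: ideal_normal simp: normal_inv_iff)

text \<open>With y = b^-1 x b in I, expanding xb = by gives x + lam x b = b + lam b y, so the
  difference in question is -x plus an additive conjugate of lam b y.\<close>

lemma ideal_star:
  assumes I: "brace_ideal A M I" and b: "b \<in> carrier A" and x: "x \<in> I"
  shows "lam x b \<otimes> inv b \<in> I"
proof -
  interpret I: subgroup I A using I by (rule ideal_subgroup)
  have xc: "x \<in> carrier A" using x by simp
  have y: "inv\<^bsub>M\<^esub> b \<otimes>\<^bsub>M\<^esub> x \<otimes>\<^bsub>M\<^esub> b \<in> I"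
    using normal.inv_op_closed1 [OF ideal_normal_mult [OF I]] b x by simp
  define y where "y = inv\<^bsub>M\<^esub> b \<otimes>\<^bsub>M\<^esub> x \<otimes>\<^bsub>M\<^esub> b"
  have yI: "y \<in> I" and yc: "y \<in> carrier A" using y b xc by (auto simp: y_def)
  have "x \<otimes>\<^bsub>M\<^esub> b = b \<otimes>\<^bsub>M\<^esub> y" using b xc
    by (simp add: y_def M.m_assoc [symmetric])
  then have "x \<otimes> lam x b = b \<otimes> lam b y" using b xc yc by (simp add: mult_conv_lam)
  then have "lam x b = inv x \<otimes> (b \<otimes> lam b y)" using b xc yc
    by (metis inv_solve_left lam_closed m_closed)
  then have "lam x b \<otimes> inv b = inv x \<otimes> (b \<otimes> lam b y \<otimes> inv b)"
    using b xc yc by (simp add: m_assoc)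
  moreover have "b \<otimes> lam b y \<otimes> inv b \<in> I" using ideal_conj ideal_lam I b yI by simp
  ultimately show ?thesis using x by simp
qed

lemma ideal_one: "brace_ideal A M {\<one>}"
  by (rule idealI) (auto simp: triv_subgroup)

lemma ideal_carrier: "brace_ideal A M (carrier A)"
  by (rule idealI) (auto simp: subgroup_self)

lemma ideal_Inter:
  assumes "\<And>I. I \<in> S \<Longrightarrow> brace_ideal A M I" "S \<noteq> {}"
  shows "brace_ideal A M (\<Inter>S)"
proof (rule idealI)
  show "subgroup (\<Inter>S) A" using assms by (intro subgroups_Inter) (auto intro: ideal_subgroup)
qed (use assms in \<open>auto intro: ideal_conj ideal_lam ideal_star\<close>)

lemma ideal_Int:
  "\<lbrakk>brace_ideal A M I; brace_ideal A M J\<rbrakk> \<Longrightarrow> brace_ideal A M (I \<inter> J)"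
  using ideal_Inter [of "{I, J}"] by auto

lemma rcos_eq_iff:
  assumes "subgroup U A" "a \<in> carrier A" "b \<in> carrier A"
  shows "U #> a = U #> b \<longleftrightarrow> a \<otimes> inv b \<in> U"
proof -
  interpret U: subgroup U A by fact
  show ?thesis
  proof
    assume "U #> a = U #> b"
    then have "a \<in> U #> b" using rcos_self [OF assms(2,1)] by simp
    then show "a \<otimes> inv b \<in> U" using assms(3) by (auto simp: r_coset_def m_assoc)
  next
    assume "a \<otimes> inv b \<in> U"
    moreover have "a = (a \<otimes> inv b) \<otimes> b" using assms by (simp add: m_assoc)
    ultimately have "a \<in> U #> b" unfolding r_coset_def by blast
    then show "U #> a = U #> b" using repr_independence assms by metis
  qed
qed

text \<open>This gives \<open>A Mod I\<close> and \<open>M Mod I\<close> a common carrier. One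
  inclusion is the star property; the other turns x + a into a times an element of I and uses
  multiplicative normality.\<close>

lemma rcos_mult_eq:
  assumes I: "brace_ideal A M I" and a: "a \<in> carrier A"
  shows "I #>\<^bsub>M\<^esub> a = I #> a"
proof -
  interpret I: subgroup I A using I by (rule ideal_subgroup)
  have 1: "x \<otimes>\<^bsub>M\<^esub> a \<in> I #> a" if x: "x \<in> I" for x
  proof -
    have "x \<otimes>\<^bsub>M\<^esub> a = (x \<otimes> (lam x a \<otimes> inv a)) \<otimes> a"
      using a x by (simp add: mult_conv_lam m_assoc)
    then show ?thesis using ideal_star [OF I a x] x unfolding r_coset_def by blast
  qed
  have 2: "x \<otimes> a \<in> I #>\<^bsub>M\<^esub> a" if x: "x \<in> I" for x
  proof -
    define y where "y = lam (inv\<^bsub>M\<^esub> a) (inv a \<otimes> x \<otimes> a)"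
    have "inv a \<otimes> x \<otimes> a \<in> I" using ideal_conj [OF I, of "inv a" x] a x by simp
    then have y: "y \<in> I" using a ideal_lam [OF I] by (simp add: y_def)
    then have z: "a \<otimes>\<^bsub>M\<^esub> y \<otimes>\<^bsub>M\<^esub> inv\<^bsub>M\<^esub> a \<in> I"
      using ideal_normal_mult [OF I] a by (simp add: M.normal_inv_iff)
    have "x \<otimes> a = a \<otimes> (inv a \<otimes> x \<otimes> a)" using a x by (simp add: m_assoc [symmetric])
    also have "\<dots> = a \<otimes>\<^bsub>M\<^esub> y" unfolding y_def using a x by (intro add_conv_mult) auto
    also have "\<dots> = (a \<otimes>\<^bsub>M\<^esub> y \<otimes>\<^bsub>M\<^esub> inv\<^bsub>M\<^esub> a) \<otimes>\<^bsub>M\<^esub> a"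
      using a y by (simp add: M.m_assoc)
    finally show ?thesis using z unfolding r_coset_def by blast
  qed
  show ?thesis using 1 2 by (auto simp: r_coset_def)
qed

end

subsection \<open>Quotient braces\<close>

declare mult_FactGroup [simp del]

context skew_brace
begin

lemma carrier_quotient: "carrier (A Mod U) = r_coset A U ` carrier A"
  by (auto simp: FactGroup_def RCOSETS_def)

lemma quotient_add:
  "\<lbrakk>brace_ideal A M U; a \<in> carrier A; b \<in> carrier A\<rbrakk>
    \<Longrightarrow> (U #> a) \<otimes>\<^bsub>A Mod U\<^esub> (U #> b) = U #> (a \<otimes> b)"
  by (simp add: mult_FactGroup normal.rcos_sum ideal_normal)

lemma quotient_mult:
  assumes U: "brace_ideal A M U" and "a \<in> carrier A" "b \<in> carrier A"
  shows "(U #> a) \<otimes>\<^bsub>M Mod U\<^esub> (U #> b) = U #> (a \<otimes>\<^bsub>M\<^esub> b)"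
proof -
  have "(U #>\<^bsub>M\<^esub> a) <#>\<^bsub>M\<^esub> (U #>\<^bsub>M\<^esub> b) = U #>\<^bsub>M\<^esub> (a \<otimes>\<^bsub>M\<^esub> b)"
    using assms by (intro normal.rcos_sum ideal_normal_mult) auto
  then show ?thesis using assms by (simp add: FactGroup_def rcos_mult_eq)
qed

lemma quotient_hom: "brace_ideal A M U \<Longrightarrow> group_hom A (A Mod U) (r_coset A U)"
  using normal.r_coset_hom_Mod [OF ideal_normal] normal.factorgroup_is_group [OF ideal_normal]
  by (simp add: group_hom_def group_hom_axioms_def is_group)

lemma quotient_inv:
  "\<lbrakk>brace_ideal A M U; a \<in> carrier A\<rbrakk> \<Longrightarrow> inv\<^bsub>A Mod U\<^esub> (U #> a) = U #> inv a"
  by (simp add: group_hom.hom_inv [OF quotient_hom])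

lemma quotient_int_pow:
  "\<lbrakk>brace_ideal A M U; a \<in> carrier A\<rbrakk> \<Longrightarrow> (U #> a) [^]\<^bsub>A Mod U\<^esub> (k::int) = U #> (a [^] k)"
  by (simp add: group_hom.hom_int_pow [OF quotient_hom])

lemma skew_brace_quotient:
  assumes U: "brace_ideal A M U"
  shows "skew_brace (A Mod U) (M Mod U)"
proof -
  have c: "carrier (M Mod U) = carrier (A Mod U)"
    using U by (auto simp: FactGroup_def RCOSETS_def rcos_mult_eq)
  have d: "a' \<otimes>\<^bsub>M Mod U\<^esub> (b' \<otimes>\<^bsub>A Mod U\<^esub> c') =
      a' \<otimes>\<^bsub>M Mod U\<^esub> b' \<otimes>\<^bsub>A Mod U\<^esub> inv\<^bsub>A Mod U\<^esub> a' \<otimes>\<^bsub>A Mod U\<^esub> (a' \<otimes>\<^bsub>M Mod U\<^esub> c')"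
    if abc: "a' \<in> carrier (A Mod U)" "b' \<in> carrier (A Mod U)" "c' \<in> carrier (A Mod U)" for a' b' c'
  proof -
    obtain a b c where "a \<in> carrier A" "b \<in> carrier A" "c \<in> carrier A"
      "a' = U #> a" "b' = U #> b" "c' = U #> c"
      using abc by (auto simp: carrier_quotient)
    then show ?thesis using U
      by (simp add: quotient_add quotient_mult quotient_inv brace_distrib)
  qed
  show ?thesis
    using normal.factorgroup_is_group [OF ideal_normal [OF U]]
      normal.factorgroup_is_group [OF ideal_normal_mult [OF U]] c d
    by (simp add: skew_brace_def skew_brace_axioms_def)
qed

lemma quotient_lam:
  "\<lbrakk>brace_ideal A M U; a \<in> carrier A; b \<in> carrier A\<rbrakk>
    \<Longrightarrow> blambda (A Mod U) (M Mod U) (U #> a) (U #> b) = U #> lam a b"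
  by (simp add: blambda_def quotient_inv quotient_mult quotient_add)

lemma rcos_in_image_iff:
  assumes "subgroup U A" "subgroup L A" "U \<subseteq> L" "a \<in> carrier A"
  shows "U #> a \<in> r_coset A U ` L \<longleftrightarrow> a \<in> L"
proof
  interpret L: subgroup L A by fact
  assume "U #> a \<in> r_coset A U ` L"
  then obtain l where l: "l \<in> L" "U #> a = U #> l" by auto
  then have "a \<otimes> inv l \<in> L" using assms by (subst (asm) rcos_eq_iff) auto
  then have "(a \<otimes> inv l) \<otimes> l \<in> L" using l by blast
  then show "a \<in> L" using assms l by (simp add: m_assoc)
qed auto

lemma ideal_image:
  assumes U: "brace_ideal A M U" and J: "brace_ideal A M J"
  shows "brace_ideal (A Mod U) (M Mod U) (r_coset A U ` J)"
proof -
  interpret Q: skew_brace "A Mod U" "M Mod U" using U by (rule skew_brace_quotient)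
  have JA: "x \<in> carrier A" if "x \<in> J" for x using ideal_subset [OF J] that by blast
  show ?thesis
  proof (rule Q.idealI)
    show "subgroup (r_coset A U ` J) (A Mod U)"
      using ideal_subgroup [OF J] by (rule group_hom.subgroup_img_is_subgroup [OF quotient_hom [OF U]])
    fix b x assume "b \<in> carrier (A Mod U)" "x \<in> r_coset A U ` J"
    then obtain b' x' where x: "b = U #> b'" "x = U #> x'" "x' \<in> J" "b' \<in> carrier A"
      by (auto simp: carrier_quotient)
    show "b \<otimes>\<^bsub>A Mod U\<^esub> x \<otimes>\<^bsub>A Mod U\<^esub> inv\<^bsub>A Mod U\<^esub> b \<in> r_coset A U ` J"
      using x U ideal_conj [OF J x(4,3)] JA
      by (simp add: quotient_add quotient_inv)
    show "blambda (A Mod U) (M Mod U) b x \<in> r_coset A U ` J"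
      using x U ideal_lam [OF J x(4,3)] JA by (simp add: quotient_lam)
    show "blambda (A Mod U) (M Mod U) x b \<otimes>\<^bsub>A Mod U\<^esub> inv\<^bsub>A Mod U\<^esub> b \<in> r_coset A U ` J"
      using x U ideal_star [OF J x(4,3)] JA
      by (simp add: quotient_lam quotient_add quotient_inv)
  qed
qed

lemma ideal_preimage:
  assumes U: "brace_ideal A M U" and L: "brace_ideal (A Mod U) (M Mod U) L"
  shows "brace_ideal A M {a \<in> carrier A. U #> a \<in> L}"
proof -
  interpret Q: skew_brace "A Mod U" "M Mod U" using U by (rule skew_brace_quotient)
  interpret L: subgroup L "A Mod U" using L by (rule Q.ideal_subgroup)
  have c: "U #> b \<in> carrier (A Mod U)" if "b \<in> carrier A" for b
    using that by (auto simp: carrier_quotient)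
  show ?thesis
  proof (rule idealI)
    show "subgroup {a \<in> carrier A. U #> a \<in> L} A"
    proof
      show "\<one> \<in> {a \<in> carrier A. U #> a \<in> L}" using group_hom.hom_one [OF quotient_hom [OF U]] L.one_closed by simp
    qed (auto simp: quotient_add [OF U, symmetric] quotient_inv [OF U, symmetric]
        intro: L.m_closed L.m_inv_closed)
    fix b x assume b: "b \<in> carrier A" and x: "x \<in> {a \<in> carrier A. U #> a \<in> L}"
    show "b \<otimes> x \<otimes> inv b \<in> {a \<in> carrier A. U #> a \<in> L}"
      using b x Q.ideal_conj [OF L c, of b "U #> x"] U
      by (simp add: quotient_add quotient_inv)
    show "lam b x \<in> {a \<in> carrier A. U #> a \<in> L}"
      using b x Q.ideal_lam [OF L c, of b "U #> x"] U by (simp add: quotient_lam)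
    show "lam x b \<otimes> inv b \<in> {a \<in> carrier A. U #> a \<in> L}"
      using b x Q.ideal_star [OF L c, of b "U #> x"] U
      by (simp add: quotient_lam quotient_add quotient_inv)
  qed
qed

lemma rcos_ideal_eq:
  assumes "brace_ideal A M U" "a \<in> U"
  shows "U #> a = U"
  using assms by (meson coset_join2 ideal_subgroup ideal_subset subsetD)

text \<open>The sum U + J, encoded as the preimage of the image of J in B/U, so that it is an ideal
  by \<open>ideal_preimage\<close> and \<open>ideal_image\<close> without computing with
  sums.\<close>

definition ideal_sum :: "'a set \<Rightarrow> 'a set \<Rightarrow> 'a set" where
  "ideal_sum U J = {a \<in> carrier A. U #> a \<in> r_coset A U ` J}"

lemma ideal_ideal_sum:
  "\<lbrakk>brace_ideal A M U; brace_ideal A M J\<rbrakk> \<Longrightarrow> brace_ideal A M (ideal_sum U J)"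
  unfolding ideal_sum_def by (intro ideal_preimage ideal_image)

lemma ideal_sum_upper1:
  assumes "brace_ideal A M U" "brace_ideal A M J"
  shows "U \<subseteq> ideal_sum U J"
proof
  fix u assume u: "u \<in> U"
  have "\<one> \<in> J" using assms ideal_subgroup subgroup.one_closed by blast
  moreover have "U #> u = U #> \<one>"
    using u assms rcos_ideal_eq subgroup.one_closed [OF ideal_subgroup] by metis
  ultimately have "U #> u \<in> r_coset A U ` J" by blast
  then show "u \<in> ideal_sum U J"
    using u ideal_subset [OF assms(1)] by (auto simp: ideal_sum_def)
qed

lemma ideal_sum_upper2: "brace_ideal A M J \<Longrightarrow> J \<subseteq> ideal_sum U J"
  using ideal_subset by (auto simp: ideal_sum_def)

end

subsection \<open>Factors of a series and their exchange\<close>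

text \<open>The coset of g generates L/U. Factors are described through elements of B, so that all
  ideals stay subsets of one type and factors can be chained and exchanged without leaving
  it.\<close>

definition cyclic_over :: "'a monoid \<Rightarrow> 'a set \<Rightarrow> 'a set \<Rightarrow> 'a \<Rightarrow> bool" where
  "cyclic_over A U L g \<longleftrightarrow>
    g \<in> L \<and> (\<forall>x\<in>L. \<exists>k::int. x \<otimes>\<^bsub>A\<^esub> inv\<^bsub>A\<^esub> (g [^]\<^bsub>A\<^esub> k) \<in> U)"

definition soc_over :: "'a monoid \<Rightarrow> 'a monoid \<Rightarrow> 'a set \<Rightarrow> 'a set \<Rightarrow> bool" where
  "soc_over A M U L \<longleftrightarrow> (\<forall>x\<in>L. \<forall>b\<in>carrier A. blambda A M x b \<otimes>\<^bsub>A\<^esub> inv\<^bsub>A\<^esub> b \<in> U \<and>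
    x \<otimes>\<^bsub>A\<^esub> b \<otimes>\<^bsub>A\<^esub> inv\<^bsub>A\<^esub> (b \<otimes>\<^bsub>A\<^esub> x) \<in> U)"

text \<open>This is |L/U| = 2: the strict inclusion gives a second coset and the last clause
  excludes a third.\<close>

definition two_step :: "'a monoid \<Rightarrow> 'a monoid \<Rightarrow> 'a set \<Rightarrow> 'a set \<Rightarrow> bool" where
  "two_step A M U L \<longleftrightarrow> brace_ideal A M U \<and> brace_ideal A M L \<and> U \<subset> L \<and>
    (\<forall>x\<in>L - U. \<forall>y\<in>L - U. x \<otimes>\<^bsub>A\<^esub> inv\<^bsub>A\<^esub> y \<in> U)"

definition inf_step :: "'a monoid \<Rightarrow> 'a monoid \<Rightarrow> 'a set \<Rightarrow> 'a set \<Rightarrow> bool" where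
  "inf_step A M U L \<longleftrightarrow> brace_ideal A M U \<and> brace_ideal A M L \<and> U \<subseteq> L \<and> soc_over A M U L \<and>
    (\<exists>g. cyclic_over A U L g \<and> (\<forall>k::int. g [^]\<^bsub>A\<^esub> k \<in> U \<longrightarrow> k = 0))"

text \<open>Factors of odd prime order in a supersoluble series carry no socle condition, so none is
  imposed. The number n is any odd multiple of the order of L/U.\<close>

definition odd_step :: "'a monoid \<Rightarrow> 'a monoid \<Rightarrow> 'a set \<Rightarrow> 'a set \<Rightarrow> bool" where
  "odd_step A M U L \<longleftrightarrow> brace_ideal A M U \<and> brace_ideal A M L \<and> U \<subseteq> L \<and>
    (\<exists>g. cyclic_over A U L g \<and> g \<notin> U \<and> (\<exists>n::int. odd n \<and> g [^]\<^bsub>A\<^esub> n \<in> U))"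

context skew_brace
begin

context
  fixes U T L
  assumes U: "brace_ideal A M U" and T: "brace_ideal A M T" and L: "brace_ideal A M L"
    and UT: "U \<subseteq> T" and TL: "T \<subseteq> L"
begin

section \<open>Transfer of factors to a quotient brace\<close>

lemma coset_mem_image_lower: "a \<in> carrier A \<Longrightarrow> U #> a \<in> r_coset A U ` T \<longleftrightarrow> a \<in> T"
  using rcos_in_image_iff [OF ideal_subgroup [OF U] ideal_subgroup [OF T] UT] .

lemma coset_mem_image_upper: "a \<in> carrier A \<Longrightarrow> U #> a \<in> r_coset A U ` L \<longleftrightarrow> a \<in> L"
  using rcos_in_image_iff [OF ideal_subgroup [OF U] ideal_subgroup [OF L]] UT TL by blast

lemma cyclic_over_image:
  "g \<in> L \<Longrightarrow> cyclic_over (A Mod U) (r_coset A U ` T) (r_coset A U ` L) (U #> g)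
    \<longleftrightarrow> cyclic_over A T L g"
  by (simp add: cyclic_over_def U quotient_add quotient_inv quotient_int_pow coset_mem_image_lower ideal_mem [OF L])

lemma soc_over_image:
  "soc_over (A Mod U) (M Mod U) (r_coset A U ` T) (r_coset A U ` L) \<longleftrightarrow> soc_over A M T L"
  by (simp add: soc_over_def carrier_quotient U quotient_add quotient_inv quotient_lam
      coset_mem_image_lower ideal_mem [OF L])

text \<open>Serves in both directions: a factor above U is pushed into B/U, where the exchange is
  proved above the zero ideal, and the exchanged factor is pulled back with T = U.\<close>

lemma inf_step_image:
  "inf_step (A Mod U) (M Mod U) (r_coset A U ` T) (r_coset A U ` L) \<longleftrightarrow> inf_step A M T L"
proof -
  have "(\<exists>g'. cyclic_over (A Mod U) (r_coset A U ` T) (r_coset A U ` L) g' \<and>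
          (\<forall>k::int. g' [^]\<^bsub>A Mod U\<^esub> k \<in> r_coset A U ` T \<longrightarrow> k = 0)) \<longleftrightarrow>
        (\<exists>g\<in>L. cyclic_over (A Mod U) (r_coset A U ` T) (r_coset A U ` L) (U #> g) \<and>
          (\<forall>k::int. (U #> g) [^]\<^bsub>A Mod U\<^esub> k \<in> r_coset A U ` T \<longrightarrow> k = 0))" (is "?l \<longleftrightarrow> _")
    unfolding cyclic_over_def by blast
  also have "\<dots> \<longleftrightarrow> (\<exists>g\<in>L. cyclic_over A T L g \<and> (\<forall>k::int. g [^] k \<in> T \<longrightarrow> k = 0))"
    by (intro bex_cong refl) (simp add: cyclic_over_image quotient_int_pow U coset_mem_image_lower ideal_mem [OF L])
  also have "\<dots> \<longleftrightarrow> (\<exists>g. cyclic_over A T L g \<and> (\<forall>k::int. g [^] k \<in> T \<longrightarrow> k = 0))" (is "_ \<longleftrightarrow> ?r")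
    unfolding cyclic_over_def by blast
  finally have "?l \<longleftrightarrow> ?r" .
  then show ?thesis
    unfolding inf_step_def using U T L TL by (simp add: ideal_image soc_over_image image_mono)
qed

lemma odd_step_image:
  "odd_step (A Mod U) (M Mod U) (r_coset A U ` T) (r_coset A U ` L) \<longleftrightarrow> odd_step A M T L"
proof -
  have "(\<exists>g'. cyclic_over (A Mod U) (r_coset A U ` T) (r_coset A U ` L) g' \<and> g' \<notin> r_coset A U ` T \<and>
          (\<exists>k::int. odd k \<and> g' [^]\<^bsub>A Mod U\<^esub> k \<in> r_coset A U ` T)) \<longleftrightarrow>
        (\<exists>g\<in>L. cyclic_over (A Mod U) (r_coset A U ` T) (r_coset A U ` L) (U #> g) \<and>
          U #> g \<notin> r_coset A U ` T \<and>
          (\<exists>k::int. odd k \<and> (U #> g) [^]\<^bsub>A Mod U\<^esub> k \<in> r_coset A U ` T))" (is "?l \<longleftrightarrow> _")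
    unfolding cyclic_over_def by blast
  also have "\<dots> \<longleftrightarrow> (\<exists>g\<in>L. cyclic_over A T L g \<and> g \<notin> T \<and> (\<exists>k::int. odd k \<and> g [^] k \<in> T))"
    by (intro bex_cong refl) (simp add: cyclic_over_image quotient_int_pow U coset_mem_image_lower ideal_mem [OF L])
  also have "\<dots> \<longleftrightarrow> (\<exists>g. cyclic_over A T L g \<and> g \<notin> T \<and> (\<exists>k::int. odd k \<and> g [^] k \<in> T))"
    (is "_ \<longleftrightarrow> ?r")
    unfolding cyclic_over_def by blast
  finally have "?l \<longleftrightarrow> ?r" .
  then show ?thesis
    unfolding odd_step_def using U T L TL by (simp add: ideal_image image_mono)
qed

lemma two_step_image:
  "two_step (A Mod U) (M Mod U) (r_coset A U ` T) (r_coset A U ` L) \<longleftrightarrow> two_step A M T L"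
proof -
  have "r_coset A U ` L - r_coset A U ` T = r_coset A U ` (L - T)"
    using coset_mem_image_lower ideal_mem [OF L] by blast
  moreover have "r_coset A U ` T \<subset> r_coset A U ` L \<longleftrightarrow> T \<subset> L"
  proof -
    have "L \<subseteq> T" if "r_coset A U ` L \<subseteq> r_coset A U ` T"
    proof
      fix a assume a: "a \<in> L"
      then have "U #> a \<in> r_coset A U ` T" using that by (simp add: image_subset_iff)
      then show "a \<in> T" using coset_mem_image_lower ideal_mem [OF L a] by simp
    qed
    then show ?thesis using TL by (metis image_mono psubset_eq subset_antisym order_refl)
  qed
  ultimately show ?thesis
    unfolding two_step_def using U T L
    by (simp add: ideal_image quotient_add quotient_inv coset_mem_image_lower ideal_mem [OF L])
qed

end

lemma image_preimage:
  assumes "L \<subseteq> carrier (A Mod U)"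
  shows "r_coset A U ` {a \<in> carrier A. U #> a \<in> L} = L"
  using assms by (auto simp: carrier_quotient)

lemma image_self:
  assumes "brace_ideal A M U"
  shows "r_coset A U ` U = {\<one>\<^bsub>A Mod U\<^esub>}"
  using assms rcos_ideal_eq [OF assms] subgroup.one_closed [OF ideal_subgroup [OF assms]] by auto

lemma preimage_upper:
  assumes U: "brace_ideal A M U" and L: "brace_ideal (A Mod U) (M Mod U) L"
  shows "U \<subseteq> {a \<in> carrier A. U #> a \<in> L}"
proof -
  interpret Q: skew_brace "A Mod U" "M Mod U" using U by (rule skew_brace_quotient)
  have "U \<in> L" using subgroup.one_closed [OF Q.ideal_subgroup [OF L]] by simp
  then show ?thesis using rcos_ideal_eq [OF U] ideal_subset [OF U] by auto
qed


text \<open>The non-zero element of T is unique, hence fixed by every \<open>lam b\<close> and by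
  additive and multiplicative conjugation. Then t + lam t b = tb = bt = b + t = t + b gives lam t b
  = b.\<close>

lemma two_step_one_central:
  assumes T: "two_step A M {\<one>} T" and t: "t \<in> T" and b: "b \<in> carrier A"
  shows "lam b t = t" "lam t b = b" "t \<otimes> b = b \<otimes> t" "b \<otimes>\<^bsub>M\<^esub> t = t \<otimes>\<^bsub>M\<^esub> b" "t \<otimes> t = \<one>"
proof -
  have I: "brace_ideal A M T" and eq: "\<And>x y. \<lbrakk>x \<in> T; y \<in> T; x \<noteq> \<one>; y \<noteq> \<one>\<rbrakk> \<Longrightarrow> x \<otimes> inv y = \<one>"
    using T by (auto simp: two_step_def)
  interpret T: subgroup T A using I by (rule ideal_subgroup)
  have uniq: "x = y" if "x \<in> T" "y \<in> T" "x \<noteq> \<one>" "y \<noteq> \<one>" for x y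
    using eq [OF that] that by (metis T.mem_carrier inv_closed inv_equality inv_inv)
  have tc: "t \<in> carrier A" using t by simp
  show l: "lam b t = t"
  proof (cases "t = \<one>")
    case False
    have "lam b t \<noteq> \<one>" using False tc b by (metis lam_minv_left lam_one_right minv_closed)
    then show ?thesis using uniq ideal_lam [OF I b t] t False by blast
  qed (use b in simp)
  show c: "t \<otimes> b = b \<otimes> t"
  proof (cases "t = \<one>")
    case False
    have "b \<otimes> t \<otimes> inv b \<noteq> \<one>"
    proof
      assume "b \<otimes> t \<otimes> inv b = \<one>"
      then have "b \<otimes> t = b" using b tc by (metis inv_solve_right l_one m_closed one_closed)
      then show False using False b tc by simp
    qed
    then have "b \<otimes> t \<otimes> inv b = t" using uniq ideal_conj [OF I b t] t False by blast
    then show ?thesis using b tc by (metis inv_solve_right' m_closed)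
  qed (use b in simp)
  show cM: "b \<otimes>\<^bsub>M\<^esub> t = t \<otimes>\<^bsub>M\<^esub> b"
  proof (cases "t = \<one>")
    case False
    have "b \<otimes>\<^bsub>M\<^esub> t \<otimes>\<^bsub>M\<^esub> inv\<^bsub>M\<^esub> b \<noteq> \<one>"
    proof
      assume "b \<otimes>\<^bsub>M\<^esub> t \<otimes>\<^bsub>M\<^esub> inv\<^bsub>M\<^esub> b = \<one>"
      then have "b \<otimes>\<^bsub>M\<^esub> t = b" using b tc M.inv_solve_right [of \<one> "b \<otimes>\<^bsub>M\<^esub> t" b] M.l_one [of b] by simp
      then show False using False b tc M.r_cancel_one [of b t] by simp
    qed
    moreover have "b \<otimes>\<^bsub>M\<^esub> t \<otimes>\<^bsub>M\<^esub> inv\<^bsub>M\<^esub> b \<in> T"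
      using ideal_normal_mult [OF I] b t by (simp add: M.normal_inv_iff)
    ultimately have "b \<otimes>\<^bsub>M\<^esub> t \<otimes>\<^bsub>M\<^esub> inv\<^bsub>M\<^esub> b = t" using uniq t False by blast
    then show ?thesis using b tc M.inv_solve_right' [of t "b \<otimes>\<^bsub>M\<^esub> t" b] by simp
  qed (use b in simp)
  have "t \<otimes> lam t b = t \<otimes> b" using cM b tc l c by (simp add: mult_conv_lam)
  then show "lam t b = b" using b tc by simp
  show "t \<otimes> t = \<one>"
  proof (cases "t = \<one>")
    case False
    then have "inv t \<noteq> \<one>" using tc by (metis inv_inv inv_one)
    then have "inv t = t" using uniq t False by blast
    then show ?thesis using tc by (metis r_inv)
  qed simp
qed

section \<open>Multiples of ideals and the exchange with a factor of order 2\<close>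

lemma int_pow_2: "x \<in> carrier A \<Longrightarrow> x [^] (2::int) = x \<otimes> x"
  using int_pow_mult [of x 1 1] by simp

context
  fixes L and m :: int
  assumes L: "brace_ideal A M L"
    and comm: "\<And>x y. \<lbrakk>x \<in> L; y \<in> L\<rbrakk> \<Longrightarrow> x \<otimes> y = y \<otimes> x"
begin

text \<open>On the abelian group L the map l -> ml is an endomorphism; it commutes with every
  \<open>lam b\<close> and every additive conjugation, which gives the next two lemmas. The star
  condition of \<open>idealI\<close> is not automatic for mL and gets its own argument in each
  application.\<close>

lemma subgroup_int_pow_image: "subgroup ((\<lambda>l. l [^] (m::int)) ` L) A"
proof
  interpret L: subgroup L A using L by (rule ideal_subgroup)
  show "\<one> \<in> (\<lambda>l. l [^] m) ` L" by (rule image_eqI [of _ _ \<one>]) auto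
  fix x y assume "x \<in> (\<lambda>l. l [^] m) ` L" "y \<in> (\<lambda>l. l [^] m) ` L"
  then obtain l k where lk: "x = l [^] m" "y = k [^] m" "l \<in> L" "k \<in> L" by auto
  have "x \<otimes> y = (l \<otimes> k) [^] m" using lk ideal_mem [OF L] int_pow_mult_distrib [OF comm [OF lk(3,4)]] by simp
  then show "x \<otimes> y \<in> (\<lambda>l. l [^] m) ` L" using lk by blast
  have "inv x = (inv l) [^] m" using lk by (simp add: int_pow_inv)
  then show "inv x \<in> (\<lambda>l. l [^] m) ` L" using lk by blast
qed (auto simp: ideal_mem [OF L])

lemma lam_int_pow_image:
  "\<lbrakk>b \<in> carrier A; x \<in> (\<lambda>l. l [^] m) ` L\<rbrakk> \<Longrightarrow> lam b x \<in> (\<lambda>l. l [^] m) ` L"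
  using ideal_lam [OF L] by (auto simp: lam_int_pow ideal_mem [OF L])

lemma conj_int_pow_image:
  assumes b: "b \<in> carrier A" and x: "x \<in> (\<lambda>l. l [^] m) ` L"
  shows "b \<otimes> x \<otimes> inv b \<in> (\<lambda>l. l [^] m) ` L"
proof -
  obtain l where l: "l \<in> L" "x = l [^] m" using x by auto
  have "group_hom A A (\<lambda>x. b \<otimes> x \<otimes> inv b)"
    using b by unfold_locales (auto simp: hom_def m_assoc inv_solve_left)
  then have "b \<otimes> l [^] m \<otimes> inv b = (b \<otimes> l \<otimes> inv b) [^] m"
    using group_hom.hom_int_pow [of A A "\<lambda>x. b \<otimes> x \<otimes> inv b" l m] l ideal_mem [OF L] by simp
  then show ?thesis using l ideal_conj [OF L b] by auto
qed

end

context
  fixes T L g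
  assumes T: "two_step A M {\<one>} T" and L: "brace_ideal A M L" and TL: "T \<subseteq> L"
    and g: "cyclic_over A T L g"
begin

private abbreviation "D \<equiv> (\<lambda>l. l [^] (2::int)) ` L"

private lemma Lc: "x \<in> L \<Longrightarrow> x \<in> carrier A"
  using ideal_subset [OF L] by blast

private lemma Tc: "x \<in> T \<Longrightarrow> x \<in> carrier A"
  using TL Lc by blast

private lemma gc: "g \<in> carrier A" and gL: "g \<in> L"
  using g Lc by (auto simp: cyclic_over_def)

private lemma repr:
  assumes "x \<in> L"
  shows "\<exists>k s. s \<in> T \<and> x = g [^] (k::int) \<otimes> s"
proof -
  obtain k :: int where k: "x \<otimes> inv (g [^] k) \<in> T"
    using g assms by (auto simp: cyclic_over_def)
  have "x = (x \<otimes> inv (g [^] k)) \<otimes> g [^] k" using assms gc Lc by (simp add: m_assoc)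
  also have "\<dots> = g [^] k \<otimes> (x \<otimes> inv (g [^] k))"
    using two_step_one_central(3) [OF T k] gc by simp
  finally show ?thesis using k by blast
qed

text \<open>L is generated by the single element g together with the additively central subgroup
  T.\<close>

private lemma comm: "x \<otimes> y = y \<otimes> x" if xL: "x \<in> L" and yL: "y \<in> L"
proof -
  obtain k s where x: "s \<in> T" "x = g [^] (k::int) \<otimes> s" using repr [OF xL] by blast
  obtain j r where y: "r \<in> T" "y = g [^] (j::int) \<otimes> r" using repr [OF yL] by blast
  note tc = two_step_one_central(3) [OF T]
  have sw: "u \<otimes> (w \<otimes> z) = w \<otimes> (u \<otimes> z)"
    if "u \<in> T" "w \<in> carrier A" "z \<in> carrier A" for u w z
    using that tc [OF that(1,2)] Tc by (simp add: m_assoc [symmetric])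
  have "x \<otimes> y = g [^] k \<otimes> (s \<otimes> (g [^] j \<otimes> r))" using x y gc Tc by (simp add: m_assoc)
  also have "\<dots> = g [^] k \<otimes> (g [^] j \<otimes> (s \<otimes> r))"
    using sw [OF x(1), of "g [^] j" r] y gc Tc by simp
  also have "\<dots> = g [^] (k + j) \<otimes> (s \<otimes> r)"
    using x y gc Tc by (simp add: m_assoc [symmetric] int_pow_mult)
  also have "\<dots> = g [^] (j + k) \<otimes> (r \<otimes> s)" using tc [OF x(1), of r] y Tc by (simp add: add.commute)
  also have "\<dots> = g [^] j \<otimes> (g [^] k \<otimes> (r \<otimes> s))"
    using x y gc Tc by (simp add: m_assoc [symmetric] int_pow_mult)
  also have "\<dots> = g [^] j \<otimes> (r \<otimes> (g [^] k \<otimes> s))"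
    using sw [OF y(1), of "g [^] k" s] x gc Tc by simp
  also have "\<dots> = y \<otimes> x" using x y gc Tc by (simp add: m_assoc)
  finally show ?thesis .
qed

text \<open>Doubling kills the component s of kg + s because T has exponent 2. So 2L is cyclic on
  2g, although L itself need not be cyclic.\<close>

private lemma squares_eq: "D = range (\<lambda>k::int. (g [^] (2::int)) [^] k)"
proof -
  have "\<exists>k::int. x [^] (2::int) = (g [^] (2::int)) [^] k" if xL: "x \<in> L" for x
  proof -
    obtain k s where x: "s \<in> T" "x = g [^] (k::int) \<otimes> s" using repr [OF xL] by blast
    have "x [^] (2::int) = (g [^] k) [^] (2::int) \<otimes> s [^] (2::int)"
      using x gc Tc two_step_one_central(3) [OF T x(1)] by (simp add: int_pow_mult_distrib)
    also have "s [^] (2::int) = \<one>" using x Tc two_step_one_central(5) [OF T x(1) one_closed] by (simp add: int_pow_2)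
    finally show ?thesis using gc by (auto simp: int_pow_pow mult.commute)
  qed
  moreover have "(g [^] (2::int)) [^] k \<in> D" for k :: int
  proof -
    have "g [^] k \<in> L" using gL L ideal_subgroup subgroup_int_pow_closed by blast
    moreover have "(g [^] (2::int)) [^] k = (g [^] k) [^] (2::int)"
      using gc by (simp add: int_pow_pow mult.commute)
    ultimately show ?thesis by blast
  qed
  ultimately show ?thesis by (auto simp: image_def)
qed

private lemma cyclic_squares: "cyclic_over A {\<one>} D (g [^] (2::int))"
proof -
  have "\<exists>k::int. x \<otimes> inv ((g [^] (2::int)) [^] k) \<in> {\<one>}" if x: "x \<in> D" for x
  proof -
    obtain k :: int where "x = (g [^] (2::int)) [^] k" using x unfolding squares_eq by auto
    then have "x \<otimes> inv ((g [^] (2::int)) [^] k) = \<one>" using gc by simp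
    then show ?thesis by blast
  qed
  then show ?thesis using gL unfolding cyclic_over_def by blast
qed

private lemma subD: "subgroup D A"
  by (rule subgroup_int_pow_image [OF L comm])

private lemma lamD: "\<lbrakk>b \<in> carrier A; x \<in> D\<rbrakk> \<Longrightarrow> lam b x \<in> D"
  by (rule lam_int_pow_image [OF L comm])

private lemma conjD: "\<lbrakk>b \<in> carrier A; x \<in> D\<rbrakk> \<Longrightarrow> b \<otimes> x \<otimes> inv b \<in> D"
  by (rule conj_int_pow_image [OF L comm])

text \<open>An element l of L changes b, by its action or by a commutator, only by some s in T;
  doing this twice adds 2s = 0. Hence 2L lies in the socle, and it stays infinite because no
  non-zero multiple of g lies in T.\<close>

lemma inf_step_swap_one:
  assumes soc: "soc_over A M T L" and inf: "\<And>k::int. g [^] k \<in> T \<Longrightarrow> k = 0"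
  shows "inf_step A M {\<one>} D"
proof -
  note cent = two_step_one_central [OF T]
  have central: "lam (l [^] (2::int)) b = b \<and> l [^] (2::int) \<otimes> b = b \<otimes> l [^] (2::int)"
    if l: "l \<in> L" and b: "b \<in> carrier A" for l b
  proof
    have lc: "l \<in> carrier A" using l by (rule Lc)
    have twice: "lam (l \<otimes>\<^bsub>M\<^esub> l) b = b"
    proof -
      define s where "s = lam l b \<otimes> inv b"
      have s: "s \<in> T" using soc l b by (simp add: soc_over_def s_def)
      have "lam l b = s \<otimes> b" using lc b by (simp add: s_def m_assoc)
      then have "lam l (lam l b) = s \<otimes> (s \<otimes> b)"
        using lc b s Tc cent(1) by (simp add: lam_add)
      also have "\<dots> = b" using b Tc [OF s] cent(5) [OF s one_closed]
        by (simp add: m_assoc [symmetric])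
      finally show ?thesis using lc b by (simp add: lam_mult)
    qed
    \<comment> \<open>Acting twice by l is acting by the product ll, whereas the claim is about 2l.
      The two differ by s in T, which acts trivially.\<close>
    define s where "s = lam l l \<otimes> inv l"
    have s: "s \<in> T" using soc l lc by (simp add: soc_over_def s_def)
    have "lam l l = s \<otimes> l" using lc by (simp add: s_def m_assoc)
    then have "l \<otimes>\<^bsub>M\<^esub> l = (l \<otimes> l) \<otimes> s"
      using lc s Tc cent(3) by (simp add: mult_conv_lam m_assoc)
    also have "\<dots> = (l \<otimes> l) \<otimes>\<^bsub>M\<^esub> s"
      using lc s Tc cent(1) by (simp add: mult_conv_lam)
    finally have "lam (l \<otimes> l) b = b" using twice lc b s Tc cent(2) by (simp add: lam_mult)
    then show "lam (l [^] (2::int)) b = b" using lc by (simp add: int_pow_2)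
    define r where "r = l \<otimes> b \<otimes> inv (b \<otimes> l)"
    have r: "r \<in> T" using soc l b by (simp add: soc_over_def r_def)
    have "l \<otimes> b = r \<otimes> (b \<otimes> l)" using lc b by (simp add: r_def m_assoc)
    then have "l \<otimes> l \<otimes> b = (l \<otimes> r) \<otimes> (b \<otimes> l)" using lc b r Tc by (simp add: m_assoc)
    also have "\<dots> = r \<otimes> (l \<otimes> b) \<otimes> l" using lc b r Tc by (simp add: cent(3) [OF r lc, symmetric]) (simp add: m_assoc)
    also have "\<dots> = (r \<otimes> r) \<otimes> (b \<otimes> l \<otimes> l)" using \<open>l \<otimes> b = r \<otimes> (b \<otimes> l)\<close> lc b r Tc by (simp add: m_assoc)
    also have "\<dots> = b \<otimes> (l \<otimes> l)" using lc b r cent(5) [OF r one_closed] by (simp add: m_assoc)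
    finally show "l [^] (2::int) \<otimes> b = b \<otimes> l [^] (2::int)" using lc by (simp add: int_pow_2)
  qed
  have soc1: "soc_over A M {\<one>} D"
    using central Lc unfolding soc_over_def by (auto simp: int_pow_closed)
  have "brace_ideal A M D"
  proof (rule idealI [OF subD conjD lamD])
    show "lam x b \<otimes> inv b \<in> D" if "b \<in> carrier A" "x \<in> D" for b x
      using soc1 that subgroup.one_closed [OF subD] by (auto simp: soc_over_def)
  qed
  moreover have "k = 0" if "(g [^] (2::int)) [^] k = \<one>" for k :: int
  proof -
    have "g [^] (2 * k) = \<one>" using that gc by (simp add: int_pow_pow)
    moreover have "\<one> \<in> T" using T by (auto simp: two_step_def)
    ultimately show ?thesis using inf [of "2 * k"] by simp
  qed
  ultimately show ?thesis
    unfolding inf_step_def using ideal_one soc1 cyclic_squares subgroup.one_closed [OF subD] by auto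
qed

text \<open>2L is the odd part of L: its order divides n, and L is 2L + T. The star property must
  come from the multiplicative normality of L, in which T is central of exponent 2 also
  multiplicatively.\<close>

lemma odd_step_swap_one:
  assumes gT: "g \<notin> T" and n: "odd (n::int)" "g [^] n \<in> T"
  shows "odd_step A M {\<one>} D"
proof -
  note cent = two_step_one_central [OF T]
  interpret D: subgroup D A by (rule subD)
  interpret T: subgroup T A using T by (auto simp: two_step_def intro: ideal_subgroup)
  let ?h = "g [^] (2::int)"
  have hc: "?h \<in> carrier A" using gc by simp
  have hn: "?h [^] n = \<one>"
  proof -
    have "?h [^] n = (g [^] n) [^] (2::int)" using gc by (simp add: int_pow_pow mult.commute)
    also have "\<dots> = \<one>" using cent(5) [OF n(2) one_closed] gc by (simp only: int_pow_2 int_pow_closed)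
    finally show ?thesis .
  qed
  have gen: "D = generate A {?h}" using hc unfolding squares_eq by (auto simp: generate_pow)
  have "card D = ord ?h" unfolding gen using hc by (simp add: generate_pow_card)
  moreover have "int (ord ?h) dvd n" using hn hc by (simp add: int_pow_eq_id)
  ultimately have oddD: "odd (card D)" using n(1) by (metis dvd_trans even_of_nat)
  have mulD: "x \<otimes>\<^bsub>M\<^esub> y \<in> D" if "x \<in> D" "y \<in> D" for x y
    using that lamD by (simp add: mult_conv_lam)
  have subM: "subgroup D M"
  proof
    show "inv\<^bsub>M\<^esub> x \<in> D" if "x \<in> D" for x
    proof -
      have "lam (inv\<^bsub>M\<^esub> x) x \<in> D" using that lamD by simp
      then show ?thesis using that by (subst minv_conv) auto
    qed
  qed (use D.subset mulD in auto)
  have repD: "\<exists>d\<in>D. \<exists>s\<in>T. x = d \<otimes>\<^bsub>M\<^esub> s" if x: "x \<in> L" for x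
  proof -
    obtain k s where s: "s \<in> T" "x = g [^] (k::int) \<otimes> s" using repr [OF x] by blast
    have "\<exists>d\<in>D. \<exists>s\<in>T. x = d \<otimes> s"
    proof (cases "even k")
      case True
      then obtain j where "k = 2 * j" by auto
      then have "g [^] k \<in> D" using gc unfolding squares_eq by (auto simp: int_pow_pow)
      then show ?thesis using s by blast
    next
      case False
      \<comment> \<open>For odd k, write kg = (k + n)g - ng: here k + n is even and ng lies in
        T.\<close>
      then obtain j where j: "k + n = 2 * j" using n(1) by (metis dvdE odd_even_add)
      have "g [^] k = g [^] (2 * j) \<otimes> inv (g [^] n)"
        using gc by (simp add: int_pow_diff [symmetric] flip: j)
      then have "x = g [^] (2 * j) \<otimes> (inv (g [^] n) \<otimes> s)" using s gc Tc by (simp add: m_assoc)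
      moreover have "g [^] (2 * j) \<in> D" using gc unfolding squares_eq by (auto simp: int_pow_pow)
      ultimately show ?thesis using s n(2) by blast
    qed
    then show ?thesis using cent(1) D.mem_carrier Tc by (metis mult_conv_lam)
  qed
  \<comment> \<open>As \<open>card D\<close> is odd, \<open>y\<close> is a multiplicative square, so its conjugate is the square of an element
    of \<open>L = D T\<close> and hence lies in \<open>D\<close>; this is equivalent to the claim.\<close>
  have star: "lam y b \<otimes> inv b \<in> D" if b: "b \<in> carrier A" and y: "y \<in> D" for b y
  proof -
    obtain c where c: "card D = 2 * c + 1" using oddD by (rule oddE)
    \<comment> \<open>A multiplicative square root of y: its square is y to the power 2c + 2, and 2c
      + 1 is the order of D.\<close>
    define z where "z = y [^]\<^bsub>M\<^esub> Suc c"
    have yc: "y \<in> carrier A" using y by simp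
    have zc: "z \<in> carrier A" using yc M.nat_pow_closed [of y "Suc c"] by (simp add: z_def)
    have zD: "z \<in> D" unfolding z_def
      using y mulD subgroup.one_closed [OF subM] by (induction c) auto
    have "y [^]\<^bsub>M\<^esub> (2 * c + 1) = \<one>\<^bsub>M\<^esub>"
    proof -
      interpret MD: group "M\<lparr>carrier := D\<rparr>" using subM by (rule M.subgroup_imp_group)
      show ?thesis
        using MD.pow_order_eq_1 [of y] y M.nat_pow_consistent [of y "card D" D] c
        by (simp add: order_def)
    qed
    then have zz: "z \<otimes>\<^bsub>M\<^esub> z = y"
      unfolding z_def using yc M.nat_pow_mult [of y "Suc c" "Suc c"] M.nat_pow_mult [of y "2 * c + 1" 1]
        M.l_one [of y] by (simp add: mult_2)
    define v where "v = inv\<^bsub>M\<^esub> b \<otimes>\<^bsub>M\<^esub> z \<otimes>\<^bsub>M\<^esub> b"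
    have vc: "v \<in> carrier A" using b zc by (simp add: v_def)
    have "z \<in> L"
      using zD ideal_subgroup [OF L] subgroup_int_pow_closed by auto
    then have "v \<in> L" unfolding v_def
      using normal.inv_op_closed1 [OF ideal_normal_mult [OF L]] b by simp
    then obtain d s where d: "d \<in> D" and s: "s \<in> T" and v: "v = d \<otimes>\<^bsub>M\<^esub> s" using repD by blast
    have dc: "d \<in> carrier A" and sc: "s \<in> carrier A" using d s Tc by auto
    have "v \<otimes>\<^bsub>M\<^esub> v = d \<otimes>\<^bsub>M\<^esub> (s \<otimes>\<^bsub>M\<^esub> d) \<otimes>\<^bsub>M\<^esub> s" using v dc sc by (simp add: M.m_assoc)
    also have "\<dots> = d \<otimes>\<^bsub>M\<^esub> d \<otimes>\<^bsub>M\<^esub> (s \<otimes>\<^bsub>M\<^esub> s)"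
      using dc sc by (simp add: cent(4) [OF s dc, symmetric] M.m_assoc)
    also have "s \<otimes>\<^bsub>M\<^esub> s = \<one>" using sc cent(1,5) [OF s] by (simp add: mult_conv_lam)
    also have "d \<otimes>\<^bsub>M\<^esub> d \<otimes>\<^bsub>M\<^esub> \<one> = d \<otimes>\<^bsub>M\<^esub> d" using dc M.r_one [of "d \<otimes>\<^bsub>M\<^esub> d"] by simp
    finally have vv: "v \<otimes>\<^bsub>M\<^esub> v \<in> D" using d mulD by simp
    define w where "w = v \<otimes>\<^bsub>M\<^esub> v"
    have wc: "w \<in> carrier A" using vc by (simp add: w_def)
    have bv: "b \<otimes>\<^bsub>M\<^esub> v = z \<otimes>\<^bsub>M\<^esub> b" using b zc by (simp add: v_def M.m_assoc [symmetric])
    have "b \<otimes>\<^bsub>M\<^esub> w = (b \<otimes>\<^bsub>M\<^esub> v) \<otimes>\<^bsub>M\<^esub> v" using b vc by (simp add: w_def M.m_assoc)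
    also have "\<dots> = z \<otimes>\<^bsub>M\<^esub> (b \<otimes>\<^bsub>M\<^esub> v)" using b vc zc by (simp add: bv M.m_assoc)
    also have "\<dots> = y \<otimes>\<^bsub>M\<^esub> b" using b zc by (simp add: bv M.m_assoc [symmetric] zz)
    finally have "b \<otimes> lam b w = y \<otimes> lam y b" using b wc yc by (simp add: mult_conv_lam)
    then have "lam y b = inv y \<otimes> (b \<otimes> lam b w)" using b wc yc
      by (metis inv_solve_left lam_closed m_closed)
    then have "lam y b \<otimes> inv b = inv y \<otimes> (b \<otimes> lam b w \<otimes> inv b)"
      using b wc yc by (simp add: m_assoc)
    moreover have "b \<otimes> lam b w \<otimes> inv b \<in> D" using conjD lamD b vv by (simp add: w_def)
    ultimately show ?thesis using y by simp
  qed
  have "brace_ideal A M D" by (rule idealI [OF subD conjD lamD star])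
  \<comment> \<open>If 2g were 0, then ng = g for the odd number n, which would put g into
    T.\<close>
  moreover have "?h \<noteq> \<one>"
  proof
    assume h1: "?h = \<one>"
    obtain j where j: "n = 2 * j + 1" using n(1) by (rule oddE)
    have "g [^] n = ?h [^] j \<otimes> g" using gc by (simp add: j int_pow_mult int_pow_pow)
    then show False using h1 gc n(2) gT by simp
  qed
  ultimately show ?thesis
    unfolding odd_step_def using ideal_one cyclic_squares n(1) hn by auto
qed

end

lemma inf_step_swap:
  assumes T: "two_step A M U T" and L: "inf_step A M T L"
  shows "\<exists>L'. inf_step A M U L'"
proof -
  have I: "brace_ideal A M U" "brace_ideal A M T" "brace_ideal A M L" and s: "U \<subseteq> T" "T \<subseteq> L"
    using T L by (auto simp: two_step_def inf_step_def)
  interpret Q: skew_brace "A Mod U" "M Mod U" using I(1) by (rule skew_brace_quotient)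
  have "two_step (A Mod U) (M Mod U) {\<one>\<^bsub>A Mod U\<^esub>} (r_coset A U ` T)"
    using two_step_image [OF I(1,1,2) order_refl s(1)] T image_self [OF I(1)] by simp
  moreover have "inf_step (A Mod U) (M Mod U) (r_coset A U ` T) (r_coset A U ` L)"
    using inf_step_image [OF I s] L by simp
  ultimately obtain L' where L': "inf_step (A Mod U) (M Mod U) {\<one>\<^bsub>A Mod U\<^esub>} L'"
    unfolding inf_step_def [of _ _ "r_coset A U ` T"] using Q.inf_step_swap_one by metis
  then have iL': "brace_ideal (A Mod U) (M Mod U) L'" by (simp add: inf_step_def)
  let ?P = "{a \<in> carrier A. U #> a \<in> L'}"
  have "inf_step A M U ?P"
    using inf_step_image [OF I(1,1) ideal_preimage [OF I(1) iL'] order_refl preimage_upper [OF I(1) iL']]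
      image_preimage [OF Q.ideal_subset [OF iL']] image_self [OF I(1)] L' by simp
  then show ?thesis by blast
qed

lemma odd_step_swap:
  assumes T: "two_step A M U T" and L: "odd_step A M T L"
  shows "\<exists>L'. odd_step A M U L'"
proof -
  have I: "brace_ideal A M U" "brace_ideal A M T" "brace_ideal A M L" and s: "U \<subseteq> T" "T \<subseteq> L"
    using T L by (auto simp: two_step_def odd_step_def)
  interpret Q: skew_brace "A Mod U" "M Mod U" using I(1) by (rule skew_brace_quotient)
  have "two_step (A Mod U) (M Mod U) {\<one>\<^bsub>A Mod U\<^esub>} (r_coset A U ` T)"
    using two_step_image [OF I(1,1,2) order_refl s(1)] T image_self [OF I(1)] by simp
  moreover have "odd_step (A Mod U) (M Mod U) (r_coset A U ` T) (r_coset A U ` L)"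
    using odd_step_image [OF I s] L by simp
  ultimately obtain L' where L': "odd_step (A Mod U) (M Mod U) {\<one>\<^bsub>A Mod U\<^esub>} L'"
    unfolding odd_step_def [of _ _ "r_coset A U ` T"] using Q.odd_step_swap_one by metis
  then have iL': "brace_ideal (A Mod U) (M Mod U) L'" by (simp add: odd_step_def)
  let ?P = "{a \<in> carrier A. U #> a \<in> L'}"
  have "odd_step A M U ?P"
    using odd_step_image [OF I(1,1) ideal_preimage [OF I(1) iL'] order_refl preimage_upper [OF I(1) iL']]
      image_preimage [OF Q.ideal_subset [OF iL']] image_self [OF I(1)] L' by simp
  then show ?thesis by blast
qed

text \<open>One swap per factor of order 2, from the top down, brings a factor above P to just above
  U. So a maximality property of U controls the whole climb from U.\<close>

lemma inf_step_descend: "\<lbrakk>(two_step A M)\<^sup>*\<^sup>* U P; inf_step A M P L\<rbrakk> \<Longrightarrow> \<exists>L'. inf_step A M U L'"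
  by (induction arbitrary: L rule: rtranclp_induct) (auto dest: inf_step_swap)

lemma odd_step_descend: "\<lbrakk>(two_step A M)\<^sup>*\<^sup>* U P; odd_step A M P L\<rbrakk> \<Longrightarrow> \<exists>L'. odd_step A M U L'"
  by (induction arbitrary: L rule: rtranclp_induct) (auto dest: odd_step_swap)

end

subsection \<open>Separation by ideals of 2-power index\<close>

text \<open>The prime alternative keeps only a generator g and the relation pg in U. Both persist
  when an ideal is added to U and L, where the factor may collapse to zero.\<close>

definition super_step :: "'a monoid \<Rightarrow> 'a monoid \<Rightarrow> 'a set \<Rightarrow> 'a set \<Rightarrow> bool" where
  "super_step A M U L \<longleftrightarrow> brace_ideal A M U \<and> brace_ideal A M L \<and> U \<subseteq> L \<and>
    (inf_step A M U L \<or>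
     (\<exists>g. cyclic_over A U L g \<and> (\<exists>p::nat. Factorial_Ring.prime p \<and> g [^]\<^bsub>A\<^esub> p \<in> U)))"

context skew_brace
begin

section \<open>Cosets and multiples in cyclic factors\<close>

lemma ideal_coset_mem_iff:
  assumes "brace_ideal A M U" "a \<in> carrier A"
  shows "U #> a = U \<longleftrightarrow> a \<in> U"
  using assms by (metis coset_join1 ideal_subgroup ideal_subset rcos_ideal_eq)

lemma coset_eq_iff:
  "\<lbrakk>brace_ideal A M U; a \<in> carrier A; b \<in> carrier A\<rbrakk> \<Longrightarrow> U #> a = U #> b \<longleftrightarrow> a \<otimes> inv b \<in> U"
  by (rule rcos_eq_iff [OF ideal_subgroup])

lemma coset_int_pow_cong:
  assumes "brace_ideal A M U" "a \<in> carrier A" "b \<in> carrier A" "U #> a = U #> b"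
  shows "U #> a [^] (k::int) = U #> b [^] k"
  using assms quotient_int_pow by metis

lemma cyclic_over_conv:
  assumes "brace_ideal A M U" "L \<subseteq> carrier A"
  shows "cyclic_over A U L g \<longleftrightarrow> g \<in> L \<and> (\<forall>x\<in>L. \<exists>k::int. U #> x = U #> g [^] k)"
proof -
  have "x \<otimes> inv (g [^] k) \<in> U \<longleftrightarrow> U #> x = U #> g [^] k" if "g \<in> L" "x \<in> L" for x and k :: int
    using that assms by (subst coset_eq_iff) auto
  then show ?thesis unfolding cyclic_over_def by blast
qed

lemma soc_over_conv:
  assumes "brace_ideal A M U" "L \<subseteq> carrier A"
  shows "soc_over A M U L \<longleftrightarrow>
    (\<forall>x\<in>L. \<forall>b\<in>carrier A. U #> lam x b = U #> b \<and> U #> (x \<otimes> b) = U #> (b \<otimes> x))"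
proof -
  have "x \<in> carrier A" if "x \<in> L" for x using that assms by auto
  then show ?thesis unfolding soc_over_def using assms(1) by (simp add: coset_eq_iff)
qed

text \<open>Elements of the socle act trivially, so in the star condition for mL the difference lam
  x b - b is zero.\<close>

lemma multiples_one:
  assumes L: "brace_ideal A M L" and g: "cyclic_over A {\<one>} L g" and soc: "soc_over A M {\<one>} L"
  shows "\<exists>D. brace_ideal A M D \<and> D \<subseteq> L \<and> cyclic_over A {\<one>} D (g [^] (m::int)) \<and> soc_over A M {\<one>} D"
proof -
  interpret L: subgroup L A using L by (rule ideal_subgroup)
  have soc': "lam x b = b" "x \<otimes> b = b \<otimes> x" if "x \<in> L" "b \<in> carrier A" for x b
    using soc that by (auto simp: soc_over_def inv_equality intro: inv_equality)
      (metis L.mem_carrier inv_closed inv_equality inv_inv lam_closed m_closed)+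
  let ?D = "(\<lambda>l. l [^] m) ` L"
  have comm: "x \<otimes> y = y \<otimes> x" if "x \<in> L" "y \<in> L" for x y
    using soc' that by simp
  have DL: "?D \<subseteq> L" using subgroup_int_pow_closed [OF L.subgroup_axioms] by auto
  have sD: "subgroup ?D A" by (rule subgroup_int_pow_image [OF L comm])
  have socD: "soc_over A M {\<one>} ?D" using soc DL by (auto simp: soc_over_def)
  have "brace_ideal A M ?D"
  proof (rule idealI [OF sD])
    show "lam x b \<otimes> inv b \<in> ?D" if "b \<in> carrier A" "x \<in> ?D" for b x
      using socD that subgroup.one_closed [OF sD] by (auto simp: soc_over_def)
  qed (use conj_int_pow_image [OF L comm] lam_int_pow_image [OF L comm] in blast)+
  moreover have "cyclic_over A {\<one>} ?D (g [^] m)"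
  proof -
    have gL: "g \<in> L" using g by (simp add: cyclic_over_def)
    have "\<exists>k::int. l [^] m \<otimes> inv ((g [^] m) [^] k) = \<one>" if l: "l \<in> L" for l
    proof -
      obtain k :: int where k: "l \<otimes> inv (g [^] k) = \<one>" using g l by (auto simp: cyclic_over_def)
      then have "l = g [^] k" using gL l
        by (metis L.mem_carrier int_pow_closed inv_closed inv_equality inv_inv)
      then have "l [^] m = (g [^] m) [^] k" using gL by (simp add: int_pow_pow mult.commute)
      then have "l [^] m \<otimes> inv ((g [^] m) [^] k) = \<one>" using gL by simp
      then show ?thesis by blast
    qed
    then show ?thesis using gL by (auto simp: cyclic_over_def)
  qed
  ultimately show ?thesis using DL socD by blast
qed

lemma multiples:
  assumes U: "brace_ideal A M U" and L: "brace_ideal A M L" and UL: "U \<subseteq> L"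
    and g: "cyclic_over A U L g" and soc: "soc_over A M U L"
  shows "\<exists>D. brace_ideal A M D \<and> U \<subseteq> D \<and> D \<subseteq> L \<and> cyclic_over A U D (g [^] (m::int)) \<and> soc_over A M U D"
proof -
  interpret Q: skew_brace "A Mod U" "M Mod U" using U by (rule skew_brace_quotient)
  have gL: "g \<in> L" using g by (simp add: cyclic_over_def)
  then have gc: "g \<in> carrier A" by (rule ideal_mem [OF L])
  have g': "cyclic_over (A Mod U) {\<one>\<^bsub>A Mod U\<^esub>} (r_coset A U ` L) (U #> g)"
    using cyclic_over_image [OF U U L order_refl UL gL] g image_self [OF U] by simp
  have soc': "soc_over (A Mod U) (M Mod U) {\<one>\<^bsub>A Mod U\<^esub>} (r_coset A U ` L)"
    using soc_over_image [OF U U L order_refl UL] soc image_self [OF U] by simp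
  obtain D where iD: "brace_ideal (A Mod U) (M Mod U) D" and DL: "D \<subseteq> r_coset A U ` L"
    and cD: "cyclic_over (A Mod U) {\<one>\<^bsub>A Mod U\<^esub>} D (U #> g [^] m)"
    and sD: "soc_over (A Mod U) (M Mod U) {\<one>\<^bsub>A Mod U\<^esub>} D"
    using Q.multiples_one [OF ideal_image [OF U L] g' soc', of m]
    by (auto simp: quotient_int_pow U gc)
  let ?P = "{a \<in> carrier A. U #> a \<in> D}"
  have P: "brace_ideal A M ?P" by (rule ideal_preimage [OF U iD])
  have UP: "U \<subseteq> ?P" by (rule preimage_upper [OF U iD])
  have im: "r_coset A U ` ?P = D" by (rule image_preimage [OF Q.ideal_subset [OF iD]])
  have "U #> g [^] m \<in> D" using cD by (simp add: cyclic_over_def)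
  then have "cyclic_over A U ?P (g [^] m)"
    using cyclic_over_image [OF U U P order_refl UP, of "g [^] m"] cD im gc image_self [OF U] by simp
  moreover have "soc_over A M U ?P"
    using soc_over_image [OF U U P order_refl UP] sD im image_self [OF U] by simp
  moreover have "?P \<subseteq> L" using DL coset_mem_image_upper [OF U U L order_refl UL] by blast
  ultimately show ?thesis using P UP by blast
qed

lemma cyclic_over_mono: "\<lbrakk>cyclic_over A U L g; U \<subseteq> V\<rbrakk> \<Longrightarrow> cyclic_over A V L g"
  unfolding cyclic_over_def by blast

lemma cyclic_over_trivial:
  assumes U: "brace_ideal A M U" and L: "brace_ideal A M L" and UL: "U \<subseteq> L"
    and g: "cyclic_over A U L g" "g \<in> U"
  shows "L = U"
proof -
  have "x \<in> U" if x: "x \<in> L" for x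
  proof -
    obtain k :: int where k: "U #> x = U #> g [^] k"
      using g(1) x unfolding cyclic_over_conv [OF U ideal_subset [OF L]] by blast
    have "g [^] k \<in> U" using g(2) ideal_subgroup [OF U] subgroup_int_pow_closed by blast
    then show ?thesis using k ideal_mem [OF L x] U ideal_coset_mem_iff rcos_ideal_eq by metis
  qed
  then show ?thesis using UL by blast
qed

lemma cyclic_two_step:
  assumes U: "brace_ideal A M U" and L: "brace_ideal A M L" and UL: "U \<subseteq> L"
    and g: "cyclic_over A U L g" "g \<notin> U" "g [^] (2::int) \<in> U"
  shows "two_step A M U L"
proof -
  have gL: "g \<in> L" using g by (simp add: cyclic_over_def)
  then have gc: "g \<in> carrier A" by (rule ideal_mem [OF L])
  have even: "g [^] (2 * j) \<in> U" for j :: int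
    using subgroup_int_pow_closed [OF ideal_subgroup [OF U] g(3), of j] gc by (simp add: int_pow_pow)
  have odd: "U #> x = U #> g" if x: "x \<in> L - U" for x
  proof -
    obtain k :: int where k: "U #> x = U #> g [^] k"
      using g(1) x unfolding cyclic_over_conv [OF U ideal_subset [OF L]] by blast
    have "odd k"
    proof
      assume "even k"
      then have "g [^] k \<in> U" using even by auto
      then show False using k x ideal_mem [OF L] U ideal_coset_mem_iff rcos_ideal_eq by (metis DiffE)
    qed
    then obtain j where "k = 2 * j + 1" by (rule oddE)
    then have "g [^] k = g [^] (2 * j) \<otimes> g" using gc by (simp add: int_pow_mult)
    then have "g [^] k \<otimes> inv g \<in> U" using even gc by (simp add: m_assoc)
    then show ?thesis using k gc U coset_eq_iff by simp
  qed
  have "x \<otimes> inv y \<in> U" if "x \<in> L - U" "y \<in> L - U" for x y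
    using odd [OF that(1)] odd [OF that(2)] that ideal_mem [OF L] by (simp add: coset_eq_iff [OF U, symmetric])
  then show ?thesis using U L UL gL g(2) unfolding two_step_def by blast
qed

text \<open>The chain consists of U + 2^i L for i = a, ..., 0. The induction peels off the top
  factor L/(U + 2L), which may be trivial, and continues below with the generator 2g.\<close>

lemma cyclic_two_power_steps:
  assumes U: "brace_ideal A M U"
  shows "\<lbrakk>brace_ideal A M L; U \<subseteq> L; cyclic_over A U L g; soc_over A M U L; g [^] (2 ^ a :: int) \<in> U\<rbrakk>
    \<Longrightarrow> (two_step A M)\<^sup>*\<^sup>* U L"
proof (induction a arbitrary: L g)
  case 0
  then have "g \<in> carrier A" by (auto simp: cyclic_over_def intro: ideal_mem)
  then have "L = U" using 0 cyclic_over_trivial [OF U] by simp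
  then show ?case by simp
next
  case (Suc a)
  have gL: "g \<in> L" using Suc.prems by (simp add: cyclic_over_def)
  then have gc: "g \<in> carrier A" by (rule ideal_mem [OF Suc.prems(1)])
  obtain D where D: "brace_ideal A M D" "U \<subseteq> D" "D \<subseteq> L" "cyclic_over A U D (g [^] (2::int))" "soc_over A M U D"
    using multiples [OF U Suc.prems(1-4), of 2] by blast
  have "(g [^] (2::int)) [^] (2 ^ a :: int) \<in> U" using Suc.prems(5) gc by (simp add: int_pow_pow)
  then have UD: "(two_step A M)\<^sup>*\<^sup>* U D" using Suc.IH D by blast
  have cDL: "cyclic_over A D L g" using Suc.prems(3) D(2) by (rule cyclic_over_mono)
  show ?case
  proof (cases "g \<in> D")
    case True
    then show ?thesis using UD cyclic_over_trivial [OF D(1) Suc.prems(1) D(3) cDL] by simp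
  next
    case False
    have "g [^] (2::int) \<in> D" using D(4) by (simp add: cyclic_over_def)
    then have "two_step A M D L" using cyclic_two_step [OF D(1) Suc.prems(1) D(3) cDL False] by blast
    then show ?thesis using UD by simp
  qed
qed

text \<open>If kg lies in U with k = 2^a m non-zero and m odd, the ideal U + 2^a L decides: either
  it equals U and L/U has 2-power order, or it gives a non-trivial factor of odd order directly
  above U.\<close>

lemma cyclic_soc_cases:
  assumes U: "brace_ideal A M U" and L: "brace_ideal A M L" and UL: "U \<subseteq> L"
    and g: "cyclic_over A U L g" and soc: "soc_over A M U L"
  shows "(two_step A M)\<^sup>*\<^sup>* U L \<or> (\<exists>Q. odd_step A M U Q) \<or> inf_step A M U L"
proof (cases "\<forall>k::int. g [^] k \<in> U \<longrightarrow> k = 0")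
  case True
  then show ?thesis using assms unfolding inf_step_def by blast
next
  case False
  have gL: "g \<in> L" using g by (simp add: cyclic_over_def)
  then have gc: "g \<in> carrier A" by (rule ideal_mem [OF L])
  obtain k :: int where k: "g [^] k \<in> U" "k \<noteq> 0" using False by blast
  obtain m where m: "k = m * 2 ^ multiplicity 2 k" "odd m"
    by (rule multiplicity_decompose' [of k 2]) (use k(2) in \<open>simp_all add: mult.commute\<close>)
  then obtain a where am: "k = 2 ^ a * m" by (metis mult.commute)
  obtain D where D: "brace_ideal A M D" "U \<subseteq> D" "D \<subseteq> L"
    "cyclic_over A U D (g [^] (2 ^ a :: int))" "soc_over A M U D"
    using multiples [OF U L UL g soc, of "2 ^ a"] by blast
  show ?thesis
  proof (cases "g [^] (2 ^ a :: int) \<in> U")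
    case True
    then show ?thesis using cyclic_two_power_steps [OF U L UL g soc] by blast
  next
    case False
    have "(g [^] (2 ^ a :: int)) [^] m \<in> U" using k am gc by (simp add: int_pow_pow)
    then have "odd_step A M U D" using U D False m(2) unfolding odd_step_def by blast
    then show ?thesis by blast
  qed
qed

lemma cyclic_prime_cases:
  assumes U: "brace_ideal A M U" and L: "brace_ideal A M L" and UL: "U \<subseteq> L"
    and g: "cyclic_over A U L g" and p: "Factorial_Ring.prime (p::nat)" "g [^] p \<in> U"
  shows "L = U \<or> two_step A M U L \<or> odd_step A M U L"
proof (cases "g \<in> U")
  case True
  then show ?thesis using cyclic_over_trivial [OF U L UL g] by simp
next
  case False
  have p': "g [^] int p \<in> U" using p(2) by (simp add: int_pow_int)
  show ?thesis
  proof (cases "p = 2")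
    case True
    then have "two_step A M U L" using cyclic_two_step [OF U L UL g False] p' by simp
    then show ?thesis by blast
  next
    case p2: False
    then have "odd (int p)" using p(1) prime_ge_2_nat [OF p(1)] prime_odd_nat [of p] by simp
    then show ?thesis using U L UL g False p' unfolding odd_step_def by blast
  qed
qed

text \<open>(P + L)/P is a homomorphic image of L/U, so it keeps the generator. This carries the
  factors of the series of B over to a climb starting from an arbitrary ideal.\<close>

lemma ideal_sum_cyclic:
  assumes P: "brace_ideal A M P" and U: "brace_ideal A M U" and L: "brace_ideal A M L"
    and UP: "U \<subseteq> P" and g: "cyclic_over A U L g"
  shows "cyclic_over A P (ideal_sum P L) g"
proof -
  have s: "ideal_sum P L \<subseteq> carrier A" by (auto simp: ideal_sum_def)
  have "\<exists>k::int. P #> x = P #> g [^] k" if x: "x \<in> ideal_sum P L" for x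
  proof -
    obtain l where l: "l \<in> L" "P #> x = P #> l" using x by (auto simp: ideal_sum_def)
    then show ?thesis
      using cyclic_over_mono [OF g UP] unfolding cyclic_over_conv [OF P ideal_subset [OF L]] by metis
  qed
  moreover have "g \<in> ideal_sum P L"
    using g ideal_sum_upper2 [OF L] by (auto simp: cyclic_over_def)
  ultimately show ?thesis unfolding cyclic_over_conv [OF P s] by blast
qed

lemma ideal_sum_soc:
  assumes P: "brace_ideal A M P" and L: "brace_ideal A M L"
    and UP: "U \<subseteq> P" and soc: "soc_over A M U L"
  shows "soc_over A M P (ideal_sum P L)"
proof -
  have s: "ideal_sum P L \<subseteq> carrier A" by (auto simp: ideal_sum_def)
  have socP: "soc_over A M P L" using soc UP unfolding soc_over_def by blast
  have "P #> lam x b = P #> b \<and> P #> (x \<otimes> b) = P #> (b \<otimes> x)"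
    if x: "x \<in> ideal_sum P L" and b: "b \<in> carrier A" for x b
  proof -
    obtain l where l: "l \<in> L" "P #> x = P #> l" using x by (auto simp: ideal_sum_def)
    have c: "x \<in> carrier A" "l \<in> carrier A" using x s l(1) ideal_mem [OF L] by auto
    have "P #> lam l b = P #> b" "P #> (l \<otimes> b) = P #> (b \<otimes> l)"
      using socP l(1) b unfolding soc_over_conv [OF P ideal_subset [OF L]] by blast+
    then show ?thesis
      using c b P l(2) by (simp add: quotient_add [symmetric] quotient_lam [symmetric])
  qed
  then show ?thesis unfolding soc_over_conv [OF P s] by blast
qed

section \<open>Maximal ideals avoiding the odd multiples of an element\<close>

lemma ideal_Union_chain:
  assumes C: "C \<noteq> {}" and chain: "\<And>I J. \<lbrakk>I \<in> C; J \<in> C\<rbrakk> \<Longrightarrow> I \<subseteq> J \<or> J \<subseteq> I"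
    and ideal: "\<And>I. I \<in> C \<Longrightarrow> brace_ideal A M I"
  shows "brace_ideal A M (\<Union>C)"
proof (rule idealI)
  show "subgroup (\<Union>C) A"
  proof
    show "\<Union>C \<subseteq> carrier A" using ideal ideal_subset by blast
    show "\<one> \<in> \<Union>C" using C subgroup.one_closed [OF ideal_subgroup [OF ideal]] by blast
    show "inv x \<in> \<Union>C" if "x \<in> \<Union>C" for x
      using that subgroup.m_inv_closed [OF ideal_subgroup [OF ideal]] by blast
    fix x y assume "x \<in> \<Union>C" "y \<in> \<Union>C"
    then obtain I J where "I \<in> C" "J \<in> C" "x \<in> I" "y \<in> J" by blast
    then obtain K where "K \<in> C" "x \<in> K" "y \<in> K" using chain by blast
    then show "x \<otimes> y \<in> \<Union>C" using subgroup.m_closed [OF ideal_subgroup [OF ideal]] by blast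
  qed
qed (use ideal ideal_conj ideal_lam ideal_star in blast)+

lemma two_step_ideal: "\<lbrakk>(two_step A M)\<^sup>*\<^sup>* U P; brace_ideal A M U\<rbrakk> \<Longrightarrow> brace_ideal A M P"
  by (induction rule: rtranclp_induct) (auto simp: two_step_def)

lemma odd_step_pow_mem:
  assumes Q: "odd_step A M I Q" and x: "x \<in> Q"
  shows "\<exists>n::int. odd n \<and> x [^] n \<in> I"
proof -
  have I: "brace_ideal A M I" and iQ: "brace_ideal A M Q" using Q by (auto simp: odd_step_def)
  obtain g n where g: "cyclic_over A I Q g" and n: "odd (n::int)" "g [^] n \<in> I"
    using Q by (auto simp: odd_step_def)
  obtain k :: int where k: "I #> x = I #> g [^] k" and gQ: "g \<in> Q"
    using g x unfolding cyclic_over_conv [OF I ideal_subset [OF iQ]] by blast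
  have c: "x \<in> carrier A" "g \<in> carrier A" using x gQ ideal_mem [OF iQ] by auto
  have "I #> x [^] n = I #> (g [^] k) [^] n" using coset_int_pow_cong [OF I _ _ k] c by simp
  also have "(g [^] k) [^] n = (g [^] n) [^] k" using c by (simp add: int_pow_pow mult.commute)
  also have "I #> \<dots> = I"
    using rcos_ideal_eq [OF I] subgroup_int_pow_closed [OF ideal_subgroup [OF I] n(2)] by blast
  finally show ?thesis using n(1) ideal_coset_mem_iff [OF I] c by auto
qed

text \<open>Write x as cg modulo I and take D = I + 2cL. An odd multiple nx in D would make nc a
  multiple of 2c, hence n even.\<close>

lemma inf_step_smaller:
  assumes L: "inf_step A M I L" and x: "x \<in> L" "x \<notin> I"
  shows "\<exists>D. brace_ideal A M D \<and> I \<subset> D \<and> (\<forall>n::int. odd n \<longrightarrow> x [^] n \<notin> D)"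
proof -
  have I: "brace_ideal A M I" and iL: "brace_ideal A M L" and IL: "I \<subseteq> L" and soc: "soc_over A M I L"
    using L by (auto simp: inf_step_def)
  obtain g where g: "cyclic_over A I L g" and inf: "\<And>k::int. g [^] k \<in> I \<Longrightarrow> k = 0"
    using L by (auto simp: inf_step_def)
  obtain c :: int where c: "I #> x = I #> g [^] c" and gL: "g \<in> L"
    using g x unfolding cyclic_over_conv [OF I ideal_subset [OF iL]] by blast
  have cc: "x \<in> carrier A" "g \<in> carrier A" using x gL ideal_mem [OF iL] by auto
  have c0: "c \<noteq> 0"
  proof
    assume "c = 0"
    then have "I #> x = I" using c rcos_ideal_eq [OF I] subgroup.one_closed [OF ideal_subgroup [OF I]] by simp
    then show False using x(2) ideal_coset_mem_iff [OF I] cc by blast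
  qed
  obtain D where D: "brace_ideal A M D" "I \<subseteq> D" "cyclic_over A I D (g [^] (2 * c))"
    using multiples [OF I iL IL g soc, of "2 * c"] by blast
  have "g [^] (2 * c) \<notin> I" using inf [of "2 * c"] c0 by auto
  then have "I \<subset> D" using D by (auto simp: cyclic_over_def)
  moreover have "x [^] n \<notin> D" if n: "odd n" for n :: int
  proof
    assume "x [^] n \<in> D"
    then obtain k :: int where "I #> x [^] n = I #> (g [^] (2 * c)) [^] k"
      using D(3) unfolding cyclic_over_conv [OF I ideal_subset [OF D(1)]] by blast
    moreover have "I #> x [^] n = I #> (g [^] c) [^] n" using coset_int_pow_cong [OF I _ _ c] cc by simp
    ultimately have "I #> g [^] (c * n) = I #> g [^] (2 * c * k)" using cc by (simp add: int_pow_pow)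
    then have "g [^] (c * n) \<otimes> inv (g [^] (2 * c * k)) \<in> I" using cc I by (simp add: coset_eq_iff)
    then have "g [^] (c * n - 2 * c * k) \<in> I" using cc by (simp add: int_pow_diff)
    then have "c * n - 2 * c * k = 0" by (rule inf)
    then have "c * (n - 2 * k) = 0" by (simp add: algebra_simps)
    then show False using c0 n by auto
  qed
  ultimately show ?thesis using D(1) by blast
qed

lemma two_power_separation:
  assumes J0: "J 0 = {\<one>}" and Jn: "J n = carrier A"
    and J: "\<And>k. k < n \<Longrightarrow> super_step A M (J k) (J (Suc k))"
    and I0: "brace_ideal A M I0" and x: "x \<in> carrier A"
    and xI0: "\<And>m::int. odd m \<Longrightarrow> x [^] m \<notin> I0"
  shows "\<exists>I. brace_ideal A M I \<and> I0 \<subseteq> I \<and> x \<notin> I \<and> (two_step A M)\<^sup>*\<^sup>* I (carrier A)"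
proof -
  define S where "S = {I. brace_ideal A M I \<and> I0 \<subseteq> I \<and> (\<forall>m::int. odd m \<longrightarrow> x [^] m \<notin> I)}"
  have "\<exists>I\<in>S. \<forall>I'\<in>S. I \<subseteq> I' \<longrightarrow> I' = I"
  proof (rule subset_Zorn_nonempty)
    show "S \<noteq> {}" using I0 xI0 by (auto simp: S_def)
    fix C assume C: "C \<noteq> {}" "subset.chain S C"
    then have sub: "C \<subseteq> S" and ch: "\<And>I J. \<lbrakk>I \<in> C; J \<in> C\<rbrakk> \<Longrightarrow> I \<subseteq> J \<or> J \<subseteq> I"
      by (auto simp: subset_chain_def)
    have "brace_ideal A M (\<Union>C)" using C(1) sub by (intro ideal_Union_chain ch) (auto simp: S_def)
    moreover have "I0 \<subseteq> \<Union>C" using C(1) sub by (auto simp: S_def)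
    moreover have "x [^] m \<notin> \<Union>C" if "odd m" for m :: int using that sub by (auto simp: S_def)
    ultimately show "\<Union>C \<in> S" by (auto simp: S_def)
  qed
  then obtain I where IS: "I \<in> S" and max: "\<And>I'. \<lbrakk>I' \<in> S; I \<subseteq> I'\<rbrakk> \<Longrightarrow> I' = I" by blast
  have I: "brace_ideal A M I" and I0I: "I0 \<subseteq> I" and xI: "\<And>m::int. odd m \<Longrightarrow> x [^] m \<notin> I"
    using IS by (auto simp: S_def)
  have big: "\<exists>m::int. odd m \<and> x [^] m \<in> Q" if "brace_ideal A M Q" "I \<subset> Q" for Q
    using that max [of Q] I0I unfolding S_def by blast
  have no_odd: "\<not> odd_step A M I Q" for Q
  proof
    assume Q: "odd_step A M I Q"
    then have "brace_ideal A M Q" "I \<subset> Q" by (auto simp: odd_step_def cyclic_over_def)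
    then obtain m :: int where m: "odd m" "x [^] m \<in> Q" using big by blast
    then obtain n :: int where n: "odd n" "(x [^] m) [^] n \<in> I" using odd_step_pow_mem [OF Q] by blast
    then show False using xI [of "m * n"] m x by (simp add: int_pow_pow)
  qed
  have no_inf: "\<not> inf_step A M I Q" for Q
  proof
    assume Q: "inf_step A M I Q"
    then obtain g where g: "cyclic_over A I Q g" "\<And>k::int. g [^] k \<in> I \<Longrightarrow> k = 0"
      and iQ: "brace_ideal A M Q" "I \<subseteq> Q" by (auto simp: inf_step_def)
    have gQ: "g \<in> Q" using g by (simp add: cyclic_over_def)
    have "g \<notin> I" using g(2) [of 1] ideal_mem [OF iQ(1) gQ] by auto
    then have "I \<subset> Q" using gQ iQ by blast
    then obtain m :: int where m: "odd m" "x [^] m \<in> Q" using big iQ by blast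
    then obtain D where D: "brace_ideal A M D" "I \<subset> D"
      and xD: "\<And>n::int. odd n \<Longrightarrow> (x [^] m) [^] n \<notin> D"
      using inf_step_smaller [OF Q m(2)] xI by blast
    \<comment> \<open>By maximality D contains some odd multiple m'x. Then m'(mx) = m(m'x) lies in
      D, against the choice of D.\<close>
    obtain m' :: int where m': "odd m'" "x [^] m' \<in> D" using big D by blast
    have "(x [^] m) [^] m' = (x [^] m') [^] m" using x by (simp add: int_pow_pow mult.commute)
    then have "(x [^] m) [^] m' \<in> D"
      using subgroup_int_pow_closed [OF ideal_subgroup [OF D(1)] m'(2)] by simp
    then show False using xD m' by blast
  qed
  \<comment> \<open>The invariant records only that P contains J k, which is what makes the next
    factor of the climb an image of the next factor of the series.\<close>
  have "\<exists>P. (two_step A M)\<^sup>*\<^sup>* I P \<and> J k \<subseteq> P" if "k \<le> n" for k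
    using that
  proof (induction k)
    case 0
    have "J 0 \<subseteq> I" using J0 subgroup.one_closed [OF ideal_subgroup [OF I]] by simp
    then show ?case by blast
  next
    case (Suc k)
    then obtain P where P: "(two_step A M)\<^sup>*\<^sup>* I P" "J k \<subseteq> P" by auto
    have iP: "brace_ideal A M P" using P(1) I by (rule two_step_ideal)
    have st: "super_step A M (J k) (J (Suc k))" using J Suc.prems by simp
    then have iJ: "brace_ideal A M (J k)" "brace_ideal A M (J (Suc k))" by (auto simp: super_step_def)
    define L where "L = ideal_sum P (J (Suc k))"
    have L: "brace_ideal A M L" "P \<subseteq> L" "J (Suc k) \<subseteq> L"
      using iP iJ by (auto simp: L_def ideal_ideal_sum ideal_sum_upper1 ideal_sum_upper2 subset_iff
          intro: ideal_sum_upper1 [THEN subsetD] ideal_sum_upper2 [THEN subsetD])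
    have "(two_step A M)\<^sup>*\<^sup>* P L \<or> (\<exists>Q. odd_step A M P Q) \<or> (\<exists>Q. inf_step A M P Q)"
      using st unfolding super_step_def
    proof (elim conjE disjE exE)
      assume "inf_step A M (J k) (J (Suc k))"
      then obtain g where g: "cyclic_over A (J k) (J (Suc k)) g" and soc: "soc_over A M (J k) (J (Suc k))"
        by (auto simp: inf_step_def)
      show ?thesis
        using cyclic_soc_cases [OF iP L(1,2) ideal_sum_cyclic [OF iP iJ P(2) g, folded L_def]
            ideal_sum_soc [OF iP iJ(2) P(2) soc, folded L_def]] by blast
    next
      fix g and p :: nat
      assume g: "cyclic_over A (J k) (J (Suc k)) g" and p: "Factorial_Ring.prime p" "g [^] p \<in> J k"
      show ?thesis
        using cyclic_prime_cases [OF iP L(1,2) ideal_sum_cyclic [OF iP iJ P(2) g, folded L_def] p(1)]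
          p(2) P(2) by auto
    qed
    moreover have "\<not> odd_step A M P Q" "\<not> inf_step A M P Q" for Q
      using no_odd no_inf odd_step_descend [OF P(1)] inf_step_descend [OF P(1)] by blast+
    ultimately have "(two_step A M)\<^sup>*\<^sup>* P L" by blast
    then show ?case using P(1) L(3) by (meson rtranclp_trans)
  qed
  from this [OF order_refl] obtain P where P: "(two_step A M)\<^sup>*\<^sup>* I P" "carrier A \<subseteq> P"
    using Jn by auto
  moreover have "P \<subseteq> carrier A" using ideal_subset [OF two_step_ideal [OF P(1) I]] .
  ultimately have "(two_step A M)\<^sup>*\<^sup>* I (carrier A)" by auto
  then show ?thesis using I I0I xI [of 1] x by auto
qed


section \<open>Consequences of a chain of factors of order 2\<close>

lemma two_step_central:
  assumes T: "two_step A M U L" and x: "x \<in> L" and b: "b \<in> carrier A"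
  shows "U #> lam b x = U #> x" "U #> lam x b = U #> b" "U #> (x \<otimes> b) = U #> (b \<otimes> x)"
proof -
  have I: "brace_ideal A M U" "brace_ideal A M L" and s: "U \<subseteq> L"
    using T by (auto simp: two_step_def)
  interpret Q: skew_brace "A Mod U" "M Mod U" using I(1) by (rule skew_brace_quotient)
  have t: "two_step (A Mod U) (M Mod U) {\<one>\<^bsub>A Mod U\<^esub>} (r_coset A U ` L)"
    using two_step_image [OF I(1,1,2) order_refl s] T image_self [OF I(1)] by simp
  have xL: "U #> x \<in> r_coset A U ` L" and bc: "U #> b \<in> carrier (A Mod U)"
    using x b by (auto simp: carrier_quotient)
  have xc: "x \<in> carrier A" using x by (rule ideal_mem [OF I(2)])
  show "U #> lam b x = U #> x" "U #> lam x b = U #> b" "U #> (x \<otimes> b) = U #> (b \<otimes> x)"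
    using Q.two_step_one_central(1-3) [OF t xL bc] I(1) xc b by (simp_all add: quotient_lam quotient_add)
qed

text \<open>The factor of the intersections embeds into L/U, so it is trivial or of order 2. The
  chain formulation allows for the trivial case.\<close>

lemma two_step_Int:
  assumes T: "two_step A M U L" and I: "brace_ideal A M I"
  shows "(two_step A M)\<^sup>*\<^sup>* (U \<inter> I) (L \<inter> I)"
proof (cases "U \<inter> I = L \<inter> I")
  case False
  have "x \<otimes> inv y \<in> U \<inter> I" if "x \<in> L \<inter> I - U \<inter> I" "y \<in> L \<inter> I - U \<inter> I" for x y
  proof
    show "x \<otimes> inv y \<in> U" using T that unfolding two_step_def by blast
    show "x \<otimes> inv y \<in> I" using that ideal_subgroup [OF I]
      by (auto intro: subgroup.m_closed subgroup.m_inv_closed)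
  qed
  moreover have "U \<inter> I \<subset> L \<inter> I" using False T by (auto simp: two_step_def)
  ultimately have "two_step A M (U \<inter> I) (L \<inter> I)"
    using T I ideal_Int unfolding two_step_def by blast
  then show ?thesis by blast
qed simp

lemma two_steps_Int:
  assumes "(two_step A M)\<^sup>*\<^sup>* U L" and I: "brace_ideal A M I"
  shows "(two_step A M)\<^sup>*\<^sup>* (U \<inter> I) (L \<inter> I)"
  using assms(1) by (induction rule: rtranclp_induct) (auto intro: rtranclp_trans two_step_Int I)

lemma two_steps_pow:
  "\<lbrakk>(two_step A M)\<^sup>*\<^sup>* I L; brace_ideal A M I; x \<in> L\<rbrakk> \<Longrightarrow> \<exists>s::nat. x [^] (2 ^ s :: int) \<in> I"
proof (induction arbitrary: x rule: rtranclp_induct)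
  case base
  then have "x [^] (2 ^ 0 :: int) \<in> I" by (simp add: ideal_mem)
  then show ?case by blast
next
  case (step Y Z)
  have iY: "brace_ideal A M Y" and iZ: "brace_ideal A M Z" using step.hyps(2) by (auto simp: two_step_def)
  interpret Y: subgroup Y A using iY by (rule ideal_subgroup)
  interpret Z: subgroup Z A using iZ by (rule ideal_subgroup)
  have xc: "x \<in> carrier A" using step.prems by simp
  \<comment> \<open>If x lies outside Y, so does -x, and Z/Y has only one non-zero coset; hence x
    and -x agree modulo Y.\<close>
  have "x \<otimes> x \<in> Y"
  proof (cases "x \<in> Y")
    case False
    then have "inv x \<in> Z - Y" using step.prems xc by (metis Diff_iff Y.m_inv_closed Z.m_inv_closed inv_inv)
    then have "x \<otimes> inv (inv x) \<in> Y" using step False unfolding two_step_def by blast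
    then show ?thesis using xc by simp
  qed simp
  then obtain s :: nat where "(x \<otimes> x) [^] (2 ^ s :: int) \<in> I" using step by blast
  then have "(x [^] (2::int)) [^] (2 ^ s :: int) \<in> I" using xc by (simp add: int_pow_2)
  then have "x [^] (2 ^ Suc s :: int) \<in> I" using xc by (simp add: int_pow_pow)
  then show ?case by blast
qed

text \<open>This is how odd factors are seen to vanish above an ideal of 2-power index: there every
  element also has a 2-power multiple in the ideal.\<close>

lemma pow_odd_two_mem:
  assumes P: "subgroup P A" and x: "x \<in> carrier A"
    and n: "odd (n::int)" "x [^] n \<in> P" and s: "x [^] (2 ^ s :: int) \<in> P"
  shows "x \<in> P"
proof -
  have "coprime n (2 ^ s)" using n(1) by (simp add: coprime_commute)
  then obtain u v where uv: "u * n + v * 2 ^ s = 1" using bezout_int [of n "2 ^ s"] by auto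
  have "x = x [^] (n * u + 2 ^ s * v)" using uv x by (simp add: mult.commute)
  also have "\<dots> = (x [^] n) [^] u \<otimes> (x [^] (2 ^ s :: int)) [^] v"
    using x by (simp only: int_pow_mult int_pow_pow)
  also have "\<dots> \<in> P" using n(2) s P subgroup_int_pow_closed subgroup.m_closed by metis
  finally show ?thesis .
qed

lemma inf_step_action:
  assumes sep: "\<And>I0 x. \<lbrakk>brace_ideal A M I0; x \<in> carrier A; \<And>m::int. odd m \<Longrightarrow> x [^] m \<notin> I0\<rbrakk> \<Longrightarrow>
      \<exists>I. brace_ideal A M I \<and> I0 \<subseteq> I \<and> x \<notin> I \<and> (two_step A M)\<^sup>*\<^sup>* I (carrier A)"
    and L: "inf_step A M U L"
  shows "\<exists>I. brace_ideal A M I \<and> (two_step A M)\<^sup>*\<^sup>* I (carrier A) \<and>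
    (\<forall>y\<in>I. \<forall>x\<in>L. U #> lam y x = U #> x)"
proof -
  have U: "brace_ideal A M U" and iL: "brace_ideal A M L" and UL: "U \<subseteq> L" and soc: "soc_over A M U L"
    using L by (auto simp: inf_step_def)
  obtain g where g: "cyclic_over A U L g" and inf: "\<And>k::int. g [^] k \<in> U \<Longrightarrow> k = 0"
    using L by (auto simp: inf_step_def)
  have gL: "g \<in> L" using g by (simp add: cyclic_over_def)
  then have gc: "g \<in> carrier A" by (rule ideal_mem [OF iL])
  have rep: "\<exists>k::int. U #> x = U #> g [^] k" if "x \<in> L" for x
    using g that unfolding cyclic_over_conv [OF U ideal_subset [OF iL]] by blast
  have uniq: "j = k" if "U #> g [^] j = U #> g [^] k" for j k :: int
  proof -
    have "g [^] (j - k) \<in> U" using that gc U by (simp add: coset_eq_iff int_pow_diff)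
    then show ?thesis using inf [of "j - k"] by simp
  qed
  \<comment> \<open>D is U + 4L. As multiples of g are distinct modulo U, an odd multiple of 2g in D
    would mean 2m = 4k with m odd, so \<open>sep\<close> applies to 2g.\<close>
  obtain D where D: "brace_ideal A M D" "U \<subseteq> D" "cyclic_over A U D (g [^] (4::int))"
    using multiples [OF U iL UL g soc, of 4] by blast
  have "(g [^] (2::int)) [^] m \<notin> D" if m: "odd m" for m :: int
  proof
    assume "(g [^] (2::int)) [^] m \<in> D"
    then obtain k :: int where "U #> (g [^] (2::int)) [^] m = U #> (g [^] (4::int)) [^] k"
      using D(3) unfolding cyclic_over_conv [OF U ideal_subset [OF D(1)]] by blast
    then have "2 * m = 4 * k" using gc uniq by (simp add: int_pow_pow)
    then show False using m by presburger
  qed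
  then obtain I where I: "brace_ideal A M I" "D \<subseteq> I" "g [^] (2::int) \<notin> I"
    "(two_step A M)\<^sup>*\<^sup>* I (carrier A)"
    using sep [OF D(1), of "g [^] (2::int)"] gc by auto
  have "U #> lam y x = U #> x" if y: "y \<in> I" and x: "x \<in> L" for x y
  proof -
    have yc: "y \<in> carrier A" using y by (rule ideal_mem [OF I(1)])
    have xc: "x \<in> carrier A" using x by (rule ideal_mem [OF iL])
    have lam_rep: "U #> lam z w = U #> (lam z g) [^] k"
      if "z \<in> carrier A" "w \<in> carrier A" "U #> w = U #> g [^] k" for z w and k :: int
    proof -
      have "U #> lam z w = U #> lam z (g [^] k)"
        using that gc U by (simp add: quotient_lam [symmetric])
      then show ?thesis using that gc by (simp add: lam_int_pow)
    qed
    obtain c :: int where c: "U #> lam y g = U #> g [^] c"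
      using rep [OF ideal_lam [OF iL yc gL]] by blast
    \<comment> \<open>The action of the multiplicative inverse of y undoes that of y, so cd = 1 and
      c is 1 or -1.\<close>
    obtain d :: int where d: "U #> lam (inv\<^bsub>M\<^esub> y) g = U #> g [^] d"
      using rep [OF ideal_lam [OF iL minv_closed [OF yc] gL]] by blast
    have "U #> g = U #> (lam y g) [^] d" using lam_rep [OF yc _ d] yc gc by simp
    also have "\<dots> = U #> (g [^] c) [^] d" using coset_int_pow_cong [OF U _ _ c] yc gc by simp
    finally have "c * d = 1" using uniq [of 1 "c * d"] gc by (simp add: int_pow_pow)
    then have "c = 1 \<or> c = -1" by (auto simp: zmult_eq_1_iff)
    \<comment> \<open>If y acts as -1, then lam y g + g lies in U, hence in I, while lam y g - g
      lies in I by the star property. Together they put 2g into I.\<close>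
    moreover have "c \<noteq> -1"
    proof
      assume "c = -1"
      then have "lam y g \<otimes> inv (g [^] (-1::int)) \<in> U" using c yc gc U by (simp add: coset_eq_iff)
      then have "lam y g \<otimes> g \<in> U" using gc by (simp add: int_pow_neg)
      then have 1: "lam y g \<otimes> g \<in> I" using D(2) I(2) by blast
      have 2: "lam y g \<otimes> inv g \<in> I" using ideal_star [OF I(1) gc y] .
      have "inv (lam y g \<otimes> inv g) \<otimes> (lam y g \<otimes> g) \<in> I"
        using 1 2 ideal_subgroup [OF I(1)] by (meson subgroup.m_closed subgroup.m_inv_closed)
      moreover have "inv (lam y g \<otimes> inv g) \<otimes> (lam y g \<otimes> g) = g \<otimes> (inv (lam y g) \<otimes> lam y g) \<otimes> g"
        using yc gc by (simp only: inv_mult_group lam_closed inv_closed inv_inv m_assoc m_closed)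
      ultimately have "g \<otimes> g \<in> I" using yc gc by simp
      then show False using I(3) gc by (simp add: int_pow_2)
    qed
    ultimately have c1: "U #> lam y g = U #> g" using c gc by simp
    obtain k :: int where k: "U #> x = U #> g [^] k" using rep [OF x] by blast
    have "U #> lam y x = U #> (lam y g) [^] k" by (rule lam_rep [OF yc xc k])
    also have "\<dots> = U #> g [^] k" using coset_int_pow_cong [OF U _ _ c1] yc gc by simp
    finally show ?thesis using k by simp
  qed
  then show ?thesis using I by blast
qed

subsection \<open>Central series and the index\<close>

text \<open>Since xb = x + lam x b and bx = b + lam b x, commuting multiplicatively reduces to
  commuting additively once both actions are trivial. So it suffices to control \<open>lam\<close>
  and additive commutators.\<close>

lemma bzeta_quotientI:
  assumes U: "brace_ideal A M U" and x: "x \<in> carrier A"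
    and c: "\<And>b. b \<in> carrier A \<Longrightarrow>
      U #> lam x b = U #> b \<and> U #> (x \<otimes> b) = U #> (b \<otimes> x) \<and> U #> lam b x = U #> x"
  shows "U #> x \<in> bzeta (A Mod U) (M Mod U)"
proof -
  interpret Q: skew_brace "A Mod U" "M Mod U" using U by (rule skew_brace_quotient)
  have "U #> (x \<otimes>\<^bsub>M\<^esub> b) = U #> (b \<otimes>\<^bsub>M\<^esub> x)" if b: "b \<in> carrier A" for b
  proof -
    have "U #> (x \<otimes> lam x b) = U #> (x \<otimes> b)" "U #> (b \<otimes> lam b x) = U #> (b \<otimes> x)"
      using c [OF b] x b U by (simp_all add: quotient_add [symmetric])
    then show ?thesis using c [OF b] x b by (simp add: mult_conv_lam)
  qed
  then show ?thesis
    unfolding bzeta_def Soc_def using U x c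
    by (auto simp: carrier_quotient quotient_lam quotient_add quotient_mult)
qed

section \<open>Subbraces, and reading off the factors of the given series\<close>

lemma r_coset_restrict [simp]: "U #>\<^bsub>A\<lparr>carrier := N\<rparr>\<^esub> x = U #> x"
  by (simp add: r_coset_def)

lemma blambda_restrict:
  "\<lbrakk>brace_ideal A M N; a \<in> N\<rbrakk> \<Longrightarrow> blambda (A\<lparr>carrier := N\<rparr>) (M\<lparr>carrier := N\<rparr>) a b = lam a b"
  using ideal_subgroup by (simp add: blambda_def m_inv_consistent)

lemma skew_brace_restrict:
  assumes N: "brace_ideal A M N"
  shows "skew_brace (A\<lparr>carrier := N\<rparr>) (M\<lparr>carrier := N\<rparr>)"
proof -
  have sA: "subgroup N A" and sM: "subgroup N M" using N by (auto simp: brace_ideal_def)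
  have "inv\<^bsub>A\<lparr>carrier := N\<rparr>\<^esub> a = inv a" if "a \<in> N" for a using sA that by (simp add: m_inv_consistent)
  then have "skew_brace_axioms (A\<lparr>carrier := N\<rparr>) (M\<lparr>carrier := N\<rparr>)"
    using ideal_mem [OF N] by (simp add: skew_brace_axioms_def brace_distrib)
  then show ?thesis
    using subgroup_imp_group [OF sA] M.subgroup_imp_group [OF sM] by (simp add: skew_brace_def)
qed

lemma ideal_restrict:
  assumes N: "brace_ideal A M N" and C: "brace_ideal A M C" and CN: "C \<subseteq> N"
  shows "brace_ideal (A\<lparr>carrier := N\<rparr>) (M\<lparr>carrier := N\<rparr>) C"
proof -
  interpret S: skew_brace "A\<lparr>carrier := N\<rparr>" "M\<lparr>carrier := N\<rparr>" using N by (rule skew_brace_restrict)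
  have sN: "subgroup N A" using N by (rule ideal_subgroup)
  have i: "inv\<^bsub>A\<lparr>carrier := N\<rparr>\<^esub> a = inv a" if "a \<in> N" for a using sN that by (simp add: m_inv_consistent)
  show ?thesis
  proof (rule S.idealI)
    show "subgroup C (A\<lparr>carrier := N\<rparr>)" using ideal_subgroup [OF C] sN CN by (rule subgroup_incl)
  qed (use CN ideal_mem [OF N] ideal_conj [OF C] ideal_lam [OF C] ideal_star [OF C] blambda_restrict [OF N] i
      in auto)
qed

lemma quot_set_eq: "quot_set A L U = r_coset A U ` L"
  by (auto simp: quot_set_def FactGroup_def RCOSETS_def)

lemma inf_step_of_quotient:
  assumes U: "brace_ideal A M U" and L: "brace_ideal A M L" and UL: "U \<subseteq> L"
    and cyc: "cyclic_group (A\<lparr>carrier := L\<rparr> Mod U)" and inf: "infinite (quot_set A L U)"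
    and soc: "quot_set A L U \<subseteq> Soc (A Mod U) (M Mod U)"
  shows "inf_step A M U L"
proof -
  interpret S: skew_brace "A\<lparr>carrier := L\<rparr>" "M\<lparr>carrier := L\<rparr>" using L by (rule skew_brace_restrict)
  have US: "brace_ideal (A\<lparr>carrier := L\<rparr>) (M\<lparr>carrier := L\<rparr>) U" using L U UL by (rule ideal_restrict)
  interpret SQ: skew_brace "A\<lparr>carrier := L\<rparr> Mod U" "M\<lparr>carrier := L\<rparr> Mod U"
    using US by (rule S.skew_brace_quotient)
  have car: "carrier (A\<lparr>carrier := L\<rparr> Mod U) = r_coset A U ` L" using quot_set_eq by (simp add: quot_set_def)
  obtain g where g: "g \<in> L"
    and gen: "r_coset A U ` L = range (\<lambda>k::int. (U #> g) [^]\<^bsub>A\<lparr>carrier := L\<rparr> Mod U\<^esub> k)"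
    using cyc unfolding SQ.cyclic_group car by blast
  have pow: "(U #> g) [^]\<^bsub>A\<lparr>carrier := L\<rparr> Mod U\<^esub> (k::int) = U #> g [^] k" for k
    using S.quotient_int_pow [OF US, of g k] g int_pow_consistent [OF ideal_subgroup [OF L] g, of k] by simp
  have gc: "g \<in> carrier A" using g by (rule ideal_mem [OF L])
  have gen': "r_coset A U ` L = range (\<lambda>k::int. U #> g [^] k)" using gen pow by simp
  have "cyclic_over A U L g"
    unfolding cyclic_over_conv [OF U ideal_subset [OF L]] using g gen' by blast
  \<comment> \<open>A relation kg in U with k non-zero would reduce every multiple of g modulo k and
    leave only finitely many cosets.\<close>
  moreover have "k = 0" if k: "g [^] k \<in> U" for k :: int
  proof (rule ccontr)
    assume k0: "k \<noteq> 0"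
    have "U #> g [^] j = U #> g [^] (j mod k)" for j :: int
    proof -
      have "g [^] (j - j mod k) = (g [^] k) [^] (j div k)"
        using gc by (simp add: int_pow_pow minus_mod_eq_mult_div)
      also have "\<dots> \<in> U" using subgroup_int_pow_closed [OF ideal_subgroup [OF U] k] .
      finally show ?thesis using gc U by (simp add: coset_eq_iff int_pow_diff)
    qed
    then have "r_coset A U ` L \<subseteq> (\<lambda>i. U #> g [^] i) ` range (\<lambda>j. j mod k)"
      unfolding gen' by auto
    \<comment> \<open>The remainder has the sign of k, so a symmetric interval covers both
      cases.\<close>
    moreover have "range (\<lambda>j. j mod k) \<subseteq> {-\<bar>k\<bar>..\<bar>k\<bar>}"
    proof
      fix i assume "i \<in> range (\<lambda>j. j mod k)"
      then obtain j where "i = j mod k" by auto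
      then have "\<bar>i\<bar> < \<bar>k\<bar>" using abs_mod_less [OF k0, of j] by simp
      then show "i \<in> {-\<bar>k\<bar>..\<bar>k\<bar>}" by auto
    qed
    ultimately have "finite (r_coset A U ` L)" by (meson finite_atLeastAtMost_int finite_imageI finite_subset)
    then show False using inf quot_set_eq by simp
  qed
  moreover have "soc_over A M U L"
  proof -
    have "U #> lam x b = U #> b \<and> U #> (x \<otimes> b) = U #> (b \<otimes> x)" if x: "x \<in> L" and b: "b \<in> carrier A" for x b
    proof -
      have "U #> x \<in> Soc (A Mod U) (M Mod U)"
        using soc x unfolding quot_set_eq by (simp add: image_subset_iff)
      moreover have "U #> b \<in> carrier (A Mod U)" using b by (simp add: carrier_quotient)
      ultimately have "blambda (A Mod U) (M Mod U) (U #> x) (U #> b) = U #> b"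
        "(U #> x) \<otimes>\<^bsub>A Mod U\<^esub> (U #> b) = (U #> b) \<otimes>\<^bsub>A Mod U\<^esub> (U #> x)"
        by (simp_all add: Soc_def)
      then show ?thesis using U ideal_mem [OF L x] b by (simp add: quotient_lam quotient_add)
    qed
    then show ?thesis unfolding soc_over_conv [OF U ideal_subset [OF L]] by blast
  qed
  ultimately show ?thesis using U L UL unfolding inf_step_def by blast
qed

lemma cyclic_of_prime_quotient:
  assumes U: "brace_ideal A M U" and L: "brace_ideal A M L" and UL: "U \<subseteq> L"
    and p: "Factorial_Ring.prime (card (quot_set A L U))"
  shows "\<exists>g. cyclic_over A U L g \<and> g [^] card (quot_set A L U) \<in> U"
proof -
  interpret S: skew_brace "A\<lparr>carrier := L\<rparr>" "M\<lparr>carrier := L\<rparr>" using L by (rule skew_brace_restrict)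
  have US: "brace_ideal (A\<lparr>carrier := L\<rparr>) (M\<lparr>carrier := L\<rparr>) U" using L U UL by (rule ideal_restrict)
  interpret SQ: skew_brace "A\<lparr>carrier := L\<rparr> Mod U" "M\<lparr>carrier := L\<rparr> Mod U"
    using US by (rule S.skew_brace_quotient)
  let ?Q = "A\<lparr>carrier := L\<rparr> Mod U"
  define p where "p = card (quot_set A L U)"
  have pp: "Factorial_Ring.prime p" using p by (simp add: p_def)
  have car: "carrier ?Q = r_coset A U ` L" using quot_set_eq by (simp add: quot_set_def)
  have ord: "order ?Q = p" using car by (simp add: order_def p_def quot_set_eq)
  have fin: "finite (carrier ?Q)" using ord pp by (metis card.infinite not_prime_0 order_def)
  have "\<not> carrier ?Q \<subseteq> {\<one>\<^bsub>?Q\<^esub>}"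
  proof
    assume "carrier ?Q \<subseteq> {\<one>\<^bsub>?Q\<^esub>}"
    then have "p \<le> 1" using ord card_mono [of "{\<one>\<^bsub>?Q\<^esub>}" "carrier ?Q"] by (simp add: order_def)
    then show False using pp prime_gt_1_nat [of p] by simp
  qed
  then obtain c where c: "c \<in> carrier ?Q" "c \<noteq> \<one>\<^bsub>?Q\<^esub>" by blast
  then obtain g where g: "g \<in> L" "c = U #> g" using car by auto
  have "SQ.ord c dvd p" using SQ.ord_dvd_group_order [OF c(1)] ord by simp
  moreover have "SQ.ord c \<noteq> 1" using c SQ.ord_eq_1 by blast
  ultimately have "SQ.ord c = p" using pp by (metis prime_nat_iff)
  then have "card (generate ?Q {c}) = card (carrier ?Q)"
    using SQ.generate_pow_card [OF c(1)] ord by (simp add: order_def)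
  moreover have "generate ?Q {c} \<subseteq> carrier ?Q" using SQ.generate_incl c by blast
  ultimately have "generate ?Q {c} = carrier ?Q" using fin card_subset_eq by blast
  then have gen: "r_coset A U ` L = {c [^]\<^bsub>?Q\<^esub> k |k. k \<in> (UNIV::int set)}"
    using SQ.generate_pow [OF c(1)] car by simp
  have pow: "c [^]\<^bsub>?Q\<^esub> (k::int) = U #> g [^] k" for k
    using S.quotient_int_pow [OF US, of g k] g int_pow_consistent [OF ideal_subgroup [OF L] g(1), of k] by simp
  have "\<exists>k::int. U #> x = U #> g [^] k" if "x \<in> L" for x
  proof -
    have "U #> x \<in> {c [^]\<^bsub>?Q\<^esub> k |k. k \<in> (UNIV::int set)}" using that unfolding gen [symmetric] by (rule imageI)
    then show ?thesis by (auto simp: pow)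
  qed
  then have "cyclic_over A U L g"
    unfolding cyclic_over_conv [OF U ideal_subset [OF L]] using g(1) by simp
  moreover have "g [^] p \<in> U"
  proof -
    have "c [^]\<^bsub>?Q\<^esub> p = \<one>\<^bsub>?Q\<^esub>" using SQ.pow_order_eq_1 [OF c(1)] ord by simp
    then have "U #> g [^] int p = U" using pow [of "int p"] by (simp add: int_pow_int)
    then show ?thesis using ideal_coset_mem_iff [OF U, of "g [^] int p"] ideal_mem [OF L g(1)]
      by (simp add: int_pow_int)
  qed
  ultimately show ?thesis unfolding p_def by blast
qed

text \<open>Cosets of F in B correspond to cosets of F/U in B/U, where Lagrange applies. F is a mere
  subgroup because the lemma is meant for \<open>Fit A M\<close>, which enters as an additive
  subgroup.\<close>

lemma card_rcosets_quotient:
  assumes U: "brace_ideal A M U" and F: "subgroup F A" and UF: "U \<subseteq> F"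
  shows "card (rcosets F) * card (r_coset A U ` F) = card (carrier (A Mod U))"
proof -
  interpret Q: skew_brace "A Mod U" "M Mod U" using U by (rule skew_brace_quotient)
  interpret F: subgroup F A by fact
  let ?H = "r_coset A U ` F"
  have H: "subgroup ?H (A Mod U)"
    using F by (rule group_hom.subgroup_img_is_subgroup [OF quotient_hom [OF U]])
  have im: "r_coset A U ` (F #> a) = ?H #>\<^bsub>A Mod U\<^esub> (U #> a)" if a: "a \<in> carrier A" for a
  proof -
    have "U #> (f \<otimes> a) = (U #> f) \<otimes>\<^bsub>A Mod U\<^esub> (U #> a)" if "f \<in> F" for f
      using that a U by (simp add: quotient_add)
    then show ?thesis by (auto simp: r_coset_def [of _ F] r_coset_def [of "A Mod U"])
  qed
  have "bij_betw (image (r_coset A U)) (rcosets F) (rcosets\<^bsub>A Mod U\<^esub> ?H)"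
  proof (rule bij_betw_imageI)
    show "inj_on (image (r_coset A U)) (rcosets F)"
    proof (rule inj_onI)
      fix R1 R2 assume R: "R1 \<in> rcosets F" "R2 \<in> rcosets F" "r_coset A U ` R1 = r_coset A U ` R2"
      then obtain a b where ab: "a \<in> carrier A" "b \<in> carrier A" "R1 = F #> a" "R2 = F #> b"
        by (auto simp: RCOSETS_def)
      have "a \<in> R1" using ab rcos_self F by simp
      then obtain r where r: "r \<in> R2" "U #> a = U #> r" using R(3) by (metis image_iff)
      then obtain f where f: "f \<in> F" "r = f \<otimes> b" using ab by (auto simp: r_coset_def)
      have "a \<otimes> inv r \<in> U" using r f ab U by (simp add: coset_eq_iff)
      then have "(a \<otimes> inv r) \<otimes> f \<in> F" using UF f by auto
      moreover have "(a \<otimes> inv r) \<otimes> f = a \<otimes> inv b"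
        using f ab by (simp add: inv_mult_group m_assoc)
      ultimately show "R1 = R2" using ab F by (simp add: rcos_eq_iff)
    qed
    show "image (r_coset A U) ` (rcosets F) = rcosets\<^bsub>A Mod U\<^esub> ?H"
      using im unfolding RCOSETS_def carrier_quotient by (auto simp: image_UN)
  qed
  then have "card (rcosets F) = card (rcosets\<^bsub>A Mod U\<^esub> ?H)" by (rule bij_betw_same_card)
  then show ?thesis using Q.lagrange [OF H] by (simp add: order_def)
qed

text \<open>The top P is a variable with its own equation so that the induction can run over the
  lower end of the chain; each factor doubles the index.\<close>

lemma two_steps_card:
  "\<lbrakk>(two_step A M)\<^sup>*\<^sup>* U P; brace_ideal A M U; P = carrier A\<rbrakk> \<Longrightarrow> \<exists>k::nat. card (carrier (A Mod U)) = 2 ^ k"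
proof (induction rule: converse_rtranclp_induct)
  case base
  have "carrier (A Mod carrier A) = {carrier A}"
    using rcos_ideal_eq [OF ideal_carrier] by (auto simp: carrier_quotient)
  then have "card (carrier (A Mod P)) = 2 ^ 0" using base by simp
  then show ?case by blast
next
  case (step U Y)
  have Y: "brace_ideal A M Y" and UY: "U \<subset> Y"
    and uy: "\<And>x y. \<lbrakk>x \<in> Y - U; y \<in> Y - U\<rbrakk> \<Longrightarrow> x \<otimes> inv y \<in> U"
    using step.hyps(1) by (auto simp: two_step_def)
  obtain k :: nat where k: "card (carrier (A Mod Y)) = 2 ^ k" using step Y by blast
  obtain t where t: "t \<in> Y - U" using UY by blast
  have tU: "U #> t \<noteq> U" using t ideal_coset_mem_iff [OF step.prems(1)] ideal_mem [OF Y] by blast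
  have "U #> x = U \<or> U #> x = U #> t" if "x \<in> Y" for x
    using that uy [of x t] t ideal_mem [OF Y] rcos_ideal_eq [OF step.prems(1)]
    by (metis DiffI DiffD1 coset_eq_iff step.prems(1))
  moreover have "U \<in> r_coset A U ` Y"
    using rcos_ideal_eq [OF step.prems(1)] UY subgroup.one_closed [OF ideal_subgroup [OF step.prems(1)]]
    by (metis image_eqI psubsetD)
  ultimately have "r_coset A U ` Y = {U, U #> t}" using t by blast
  then have "card (r_coset A U ` Y) = 2" using tU by simp
  then have "card (carrier (A Mod U)) = 2 ^ Suc k"
    using card_rcosets_quotient [OF step.prems(1) ideal_subgroup [OF Y] psubset_imp_subset [OF UY]] k
    by (simp add: FactGroup_def)
  then show ?case by blast
qed


text \<open>N centralises (I + L)/(I + U). For an infinite L/U this is the socle condition together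
  with the choice of N; an image of order 2 is central in B/P. An odd image is zero: each j in L has
  an odd multiple in P by the factor and a 2-power multiple in P by the index of I.\<close>

lemma two_steps_central:
  assumes step: "super_step A M U L"
    and N: "\<And>y x. \<lbrakk>inf_step A M U L; y \<in> N; x \<in> L\<rbrakk> \<Longrightarrow> U #> lam y x = U #> x"
    and NA: "N \<subseteq> carrier A"
    and I: "brace_ideal A M I" "(two_step A M)\<^sup>*\<^sup>* I (carrier A)"
    and x: "x \<in> ideal_sum I L" and b: "b \<in> N"
    and P: "P = ideal_sum I U"
  shows "P #> lam x b = P #> b" "P #> (x \<otimes> b) = P #> (b \<otimes> x)" "P #> lam b x = P #> x"
proof -
  have iU: "brace_ideal A M U" and iL: "brace_ideal A M L" using step by (auto simp: super_step_def)
  have iP: "brace_ideal A M P" unfolding P using I(1) iU by (rule ideal_ideal_sum)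
  have IP: "I \<subseteq> P" unfolding P using I(1) iU by (rule ideal_sum_upper1)
  have UP: "U \<subseteq> P" unfolding P using iU by (rule ideal_sum_upper2)
  have bc: "b \<in> carrier A" using b NA by blast
  obtain j where j: "j \<in> L" "I #> x = I #> j" and xc: "x \<in> carrier A" using x by (auto simp: ideal_sum_def)
  have jc: "j \<in> carrier A" using j by (auto intro: ideal_mem [OF iL])
  have coarsen: "P #> u = P #> v" if "u \<in> carrier A" "v \<in> carrier A" "V #> u = V #> v"
    "V \<subseteq> P" "brace_ideal A M V" for u v V
    using that coset_eq_iff [OF iP] coset_eq_iff [OF that(5)] by blast
  have xj: "P #> x = P #> j" using coarsen [OF xc jc j(2) IP I(1)] .
  have triv: "P #> lam j b = P #> b \<and> P #> (j \<otimes> b) = P #> (b \<otimes> j) \<and> P #> lam b j = P #> j"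
    if jP: "j \<in> P"
  proof -
    interpret Q: skew_brace "A Mod P" "M Mod P" using iP by (rule skew_brace_quotient)
    have "P #> j = \<one>\<^bsub>A Mod P\<^esub>" using rcos_ideal_eq [OF iP jP] by simp
    moreover have "P #> b \<in> carrier (A Mod P)" using bc by (simp add: carrier_quotient)
    moreover have "P #> lam b j = P #> j"
      using rcos_ideal_eq [OF iP jP] rcos_ideal_eq [OF iP ideal_lam [OF iP bc jP]] by simp
    ultimately show ?thesis
      using iP bc jc Q.lam_one_left Q.l_one Q.r_one
      by (simp add: quotient_lam [symmetric] quotient_add [symmetric] del: one_FactGroup)
  qed
  have "P #> lam j b = P #> b \<and> P #> (j \<otimes> b) = P #> (b \<otimes> j) \<and> P #> lam b j = P #> j"
  proof (cases "inf_step A M U L")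
    case True
    then have "soc_over A M U L" by (simp add: inf_step_def)
    then have "U #> lam j b = U #> b" "U #> (j \<otimes> b) = U #> (b \<otimes> j)"
      using j(1) bc unfolding soc_over_conv [OF iU ideal_subset [OF iL]] by blast+
    moreover have "U #> lam b j = U #> j" using N [OF True b j(1)] .
    ultimately show ?thesis 
      using bc jc by (intro conjI coarsen [OF _ _ _ UP iU]) simp_all
  next
    case False
    then obtain g and p :: nat where g: "cyclic_over A U L g" and p: "Factorial_Ring.prime p" "g [^] p \<in> U"
      using step by (auto simp: super_step_def)
    define K where "K = ideal_sum P L"
    have K: "brace_ideal A M K" "P \<subseteq> K" "L \<subseteq> K"
      unfolding K_def using ideal_ideal_sum [OF iP iL] ideal_sum_upper1 [OF iP iL] ideal_sum_upper2 [OF iL]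
      by simp_all
    have gK: "cyclic_over A P K g" unfolding K_def using iP iU iL UP g by (rule ideal_sum_cyclic)
    consider "K = P" | "two_step A M P K" | "odd_step A M P K"
      using cyclic_prime_cases [OF iP K(1,2) gK p(1)] p(2) UP by blast
    then show ?thesis
    proof cases
      case 1
      then show ?thesis using triv K(3) j(1) by blast
    next
      case 2
      then show ?thesis using two_step_central [OF 2 _ bc] K(3) j(1) by blast
    next
      case 3
      obtain n :: int where n: "odd n" "j [^] n \<in> P" using odd_step_pow_mem [OF 3] K(3) j(1) by blast
      obtain s :: nat where "j [^] (2 ^ s :: int) \<in> I" using two_steps_pow [OF I(2,1) jc] by blast
      then have "j [^] (2 ^ s :: int) \<in> P" using IP by blast
      then have "j \<in> P" using pow_odd_two_mem [OF ideal_subgroup [OF iP] jc n] by blast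
      then show ?thesis by (rule triv)
    qed
  qed
  then show "P #> lam x b = P #> b" "P #> (x \<otimes> b) = P #> (b \<otimes> x)" "P #> lam b x = P #> x"
    using iP xc jc bc xj by (metis quotient_lam, metis quotient_add, metis quotient_lam)
qed

lemma centrally_nilpotent_two_power_index:
  assumes J0: "J 0 = {\<one>}" and Jn: "J n = carrier A"
    and J: "\<And>k. k < n \<Longrightarrow> super_step A M (J k) (J (Suc k))"
    and tf: "\<And>x m. \<lbrakk>x \<in> carrier A; odd (m::nat); x [^] m = \<one>\<rbrakk> \<Longrightarrow> x = \<one>"
  shows "\<exists>N. B_centrally_nilpotent A M N \<and> (two_step A M)\<^sup>*\<^sup>* N (carrier A)"
proof -
  have sep: "\<exists>I. brace_ideal A M I \<and> I0 \<subseteq> I \<and> x \<notin> I \<and> (two_step A M)\<^sup>*\<^sup>* I (carrier A)"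
    if "brace_ideal A M I0" "x \<in> carrier A" "\<And>m::int. odd m \<Longrightarrow> x [^] m \<notin> I0" for I0 x
    using two_power_separation [of J n I0 x] J0 Jn J that by blast
  \<comment> \<open>Only infinite factors restrict N, since those of order 2 are central and those
    of odd order vanish in the closures. Each restriction costs one ideal of 2-power index, so
    finitely many intersections suffice.\<close>
  define good where "good N k \<longleftrightarrow> (inf_step A M (J k) (J (Suc k)) \<longrightarrow>
    (\<forall>y\<in>N. \<forall>x\<in>J (Suc k). J k #> lam y x = J k #> x))" for N k
  have "\<exists>N. brace_ideal A M N \<and> (two_step A M)\<^sup>*\<^sup>* N (carrier A) \<and> (\<forall>k<m. good N k)" for m
  proof (induction m)
    case 0
    then show ?case using ideal_carrier by blast
  next
    case (Suc m)
    then obtain N where N: "brace_ideal A M N" "(two_step A M)\<^sup>*\<^sup>* N (carrier A)" "\<forall>k<m. good N k" by blast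
    have "\<exists>I. brace_ideal A M I \<and> (two_step A M)\<^sup>*\<^sup>* I (carrier A) \<and> good I m"
    proof (cases "inf_step A M (J m) (J (Suc m))")
      case True
      then show ?thesis using inf_step_action [OF sep True] unfolding good_def by blast
    next
      case False
      then show ?thesis using ideal_carrier unfolding good_def by blast
    qed
    then obtain I where I: "brace_ideal A M I" "(two_step A M)\<^sup>*\<^sup>* I (carrier A)" "good I m" by blast
    have "(two_step A M)\<^sup>*\<^sup>* (N \<inter> I) (carrier A \<inter> I)" using two_steps_Int [OF N(2) I(1)] .
    also have "carrier A \<inter> I = I" using ideal_subset [OF I(1)] by blast
    finally have "(two_step A M)\<^sup>*\<^sup>* (N \<inter> I) (carrier A)" using I(2) by simp
    moreover have "\<forall>k<Suc m. good (N \<inter> I) k" using N(3) I(3) unfolding good_def less_Suc_eq by blast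
    ultimately show ?case using ideal_Int [OF N(1) I(1)] by blast
  qed
  then obtain N where N: "brace_ideal A M N" "(two_step A M)\<^sup>*\<^sup>* N (carrier A)" "\<forall>k<n. good N k" by blast
  have iJ: "brace_ideal A M (J k)" if "k \<le> n" for k
    using that J ideal_carrier Jn unfolding super_step_def by (cases "k = n") auto
  define T where "T = {I. brace_ideal A M I \<and> (two_step A M)\<^sup>*\<^sup>* I (carrier A)}"
  \<comment> \<open>The intersection over T may be infinite; the terms C k are only required to be
    ideals, and the index is controlled through N alone.\<close>
  define C where "C k = N \<inter> (\<Inter>I\<in>T. ideal_sum I (J k))" for k
  have T0: "carrier A \<in> T" using ideal_carrier by (simp add: T_def)
  have iC: "brace_ideal A M (C k)" if "k \<le> n" for k
    unfolding C_def using N(1) T0 iJ [OF that]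
    by (intro ideal_Int ideal_Inter) (auto simp: T_def ideal_ideal_sum)
  have CN: "C k \<subseteq> N" for k by (auto simp: C_def)
  have C0: "C 0 = {\<one>}"
  proof
    show "C 0 \<subseteq> {\<one>}"
    proof
      fix x assume x: "x \<in> C 0"
      then have xc: "x \<in> carrier A" using CN ideal_mem [OF N(1)] by blast
      show "x \<in> {\<one>}"
      proof (rule ccontr)
        assume x1: "x \<notin> {\<one>}"
        have "x [^] m \<notin> {\<one>}" if m: "odd m" for m :: int
        proof
          assume "x [^] m \<in> {\<one>}"
          then have xm: "x [^] m = \<one>" by simp
          \<comment> \<open>Separation speaks of integer multiples, the torsion hypothesis of
            natural ones; the sign is removed here.\<close>
          obtain l :: nat where l: "m = int l \<or> m = - int l" by (cases m rule: int_cases2) auto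
          then have "x [^] l = \<one> \<or> inv (x [^] l) = \<one>"
            using xm int_pow_int [of A x l] int_pow_neg_int [OF xc, of l] by metis
          then have "x [^] l = \<one>" using xc by (metis inv_inv inv_one nat_pow_closed)
          moreover have "odd l" using m l by auto
          ultimately show False using tf [OF xc] x1 by blast
        qed
        then obtain I where I: "I \<in> T" "x \<notin> I" using sep [OF ideal_one xc] unfolding T_def by blast
        then have iI: "brace_ideal A M I" by (simp add: T_def)
        have "x \<in> ideal_sum I {\<one>}" using x I(1) J0 by (auto simp: C_def)
        then have "I #> x = I #> \<one>" by (auto simp: ideal_sum_def)
        then have "I #> x = I" using rcos_ideal_eq [OF iI] subgroup.one_closed [OF ideal_subgroup [OF iI]] by simp
        then show False using I(2) ideal_coset_mem_iff [OF iI xc] by blast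
      qed
    qed
    show "{\<one>} \<subseteq> C 0" using subgroup.one_closed [OF ideal_subgroup [OF iC]] by simp
  qed
  have Cn: "C n = N"
    using Jn ideal_mem [OF N(1)] by (auto simp: C_def ideal_sum_def)
  have mono: "C k \<subseteq> C (Suc k)" if "k < n" for k
  proof -
    have "J k \<subseteq> J (Suc k)" using J [OF that] by (simp add: super_step_def)
    then have "ideal_sum I (J k) \<subseteq> ideal_sum I (J (Suc k))" for I unfolding ideal_sum_def by blast
    then show ?thesis unfolding C_def by blast
  qed
  have central: "quot_set A (C (Suc k)) (C k) \<subseteq> bzeta (A\<lparr>carrier := N\<rparr> Mod C k) (M\<lparr>carrier := N\<rparr> Mod C k)"
    if k: "k < n" for k
  proof
    interpret S: skew_brace "A\<lparr>carrier := N\<rparr>" "M\<lparr>carrier := N\<rparr>" using N(1) by (rule skew_brace_restrict)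
    have Ck: "brace_ideal A M (C k)" using k by (intro iC) simp
    have CS: "brace_ideal (A\<lparr>carrier := N\<rparr>) (M\<lparr>carrier := N\<rparr>) (C k)"
      using N(1) Ck CN by (rule ideal_restrict)
    fix c assume "c \<in> quot_set A (C (Suc k)) (C k)"
    then obtain x where x: "x \<in> C (Suc k)" "c = C k #> x" by (auto simp: quot_set_eq)
    have xN: "x \<in> N" using x CN by blast
    \<comment> \<open>Congruence modulo C k is congruence modulo every I + J k, once the difference
      is known to lie in N.\<close>
    have eq: "C k #> u = C k #> v"
      if uv: "u \<in> N" "v \<in> N" and I: "\<And>I. I \<in> T \<Longrightarrow> ideal_sum I (J k) #> u = ideal_sum I (J k) #> v" for u v
    proof -
      have uc: "u \<in> carrier A" "v \<in> carrier A" using uv ideal_mem [OF N(1)] by auto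
      have "u \<otimes> inv v \<in> ideal_sum I (J k)" if "I \<in> T" for I
      proof -
        have "brace_ideal A M (ideal_sum I (J k))"
          using that iJ [of k] k by (auto simp: T_def intro: ideal_ideal_sum)
        then show ?thesis using I [OF that] uc by (simp add: coset_eq_iff)
      qed
      moreover have "u \<otimes> inv v \<in> N"
        using uv ideal_subgroup [OF N(1)] by (meson subgroup.m_closed subgroup.m_inv_closed)
      ultimately have "u \<otimes> inv v \<in> C k" by (auto simp: C_def)
      then show ?thesis using uc Ck by (simp add: coset_eq_iff)
    qed
    \<comment> \<open>Here b ranges over N, as the quotient of the subbrace N demands: elements
      outside N may act as -1 on an infinite factor.\<close>
    have "C k #> lam x b = C k #> b \<and> C k #> (x \<otimes> b) = C k #> (b \<otimes> x) \<and> C k #> lam b x = C k #> x"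
      if b: "b \<in> N" for b
    proof -
      have c: "lam x b \<in> N" "lam b x \<in> N" "x \<otimes> b \<in> N" "b \<otimes> x \<in> N"
        using xN b ideal_mem [OF N(1)] ideal_lam [OF N(1)] subgroup.m_closed [OF ideal_subgroup [OF N(1)]]
        by auto
      have *: "ideal_sum I (J k) #> lam x b = ideal_sum I (J k) #> b"
          "ideal_sum I (J k) #> (x \<otimes> b) = ideal_sum I (J k) #> (b \<otimes> x)"
          "ideal_sum I (J k) #> lam b x = ideal_sum I (J k) #> x" if I: "I \<in> T" for I
      proof -
        have xI: "x \<in> ideal_sum I (J (Suc k))" using x(1) I by (auto simp: C_def)
        have g: "\<And>y z. \<lbrakk>inf_step A M (J k) (J (Suc k)); y \<in> N; z \<in> J (Suc k)\<rbrakk> \<Longrightarrow> J k #> lam y z = J k #> z"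
          using N(3) k unfolding good_def by blast
        have I': "brace_ideal A M I" "(two_step A M)\<^sup>*\<^sup>* I (carrier A)" using I by (auto simp: T_def)
        show "ideal_sum I (J k) #> lam x b = ideal_sum I (J k) #> b"
          "ideal_sum I (J k) #> (x \<otimes> b) = ideal_sum I (J k) #> (b \<otimes> x)"
          "ideal_sum I (J k) #> lam b x = ideal_sum I (J k) #> x"
          using two_steps_central [OF J [OF k] g ideal_subset [OF N(1)] I' xI b refl] by auto
      qed
      show ?thesis using eq c xN b * by blast
    qed
    then have "C k #>\<^bsub>A\<lparr>carrier := N\<rparr>\<^esub> x \<in> bzeta (A\<lparr>carrier := N\<rparr> Mod C k) (M\<lparr>carrier := N\<rparr> Mod C k)"
      using xN N(1) by (intro S.bzeta_quotientI [OF CS]) (auto simp: blambda_restrict)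
    then show "c \<in> bzeta (A\<lparr>carrier := N\<rparr> Mod C k) (M\<lparr>carrier := N\<rparr> Mod C k)" using x(2) by simp
  qed
  have "B_centrally_nilpotent A M N"
    unfolding B_centrally_nilpotent_def
    using N(1) C0 Cn iC mono central by (intro conjI exI [of _ C] exI [of _ n]) auto
  then show ?thesis using N(2) by blast
qed

end

theorem theorem3p45:
  fixes A M :: "'a monoid"
  assumes "brace A M"
    and "supersoluble_brace A M"
    and "\<forall>x\<in>carrier A. (\<exists>n::nat. odd n \<and> x [^]\<^bsub>A\<^esub> n = \<one>\<^bsub>A\<^esub>) \<longrightarrow> x = \<one>\<^bsub>A\<^esub>"
  shows "\<exists>k::nat. card (carrier (A Mod Fit A M)) = 2 ^ k"
proof -
  interpret skew_brace A M using assms(1) by (simp add: brace_iff_skew_brace)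
  obtain J n where J0: "J 0 = {\<one>\<^bsub>A\<^esub>}" and Jn: "J n = carrier A"
    and iJ: "\<And>k. k \<le> n \<Longrightarrow> brace_ideal A M (J k)"
    and J: "\<And>k. k < n \<Longrightarrow> J k \<subseteq> J (Suc k) \<and>
      ((cyclic_group (A\<lparr>carrier := J (Suc k)\<rparr> Mod J k) \<and> infinite (quot_set A (J (Suc k)) (J k)) \<and>
        quot_set A (J (Suc k)) (J k) \<subseteq> Soc (A Mod J k) (M Mod J k)) \<or>
       Factorial_Ring.prime (card (quot_set A (J (Suc k)) (J k))))"
    using assms(2) unfolding supersoluble_brace_def by blast
  have "super_step A M (J k) (J (Suc k))" if k: "k < n" for k
  proof -
    have i: "brace_ideal A M (J k)" "brace_ideal A M (J (Suc k))" using iJ k by auto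
    show ?thesis
      using J [OF k] i inf_step_of_quotient [OF i] cyclic_of_prime_quotient [OF i]
      unfolding super_step_def by blast
  qed
  then obtain N where N: "B_centrally_nilpotent A M N" "(two_step A M)\<^sup>*\<^sup>* N (carrier A)"
    using centrally_nilpotent_two_power_index [OF J0 Jn] assms(3) by blast
  have iN: "brace_ideal A M N" using N(1) by (simp add: B_centrally_nilpotent_def)
  have F: "subgroup (Fit A M) A"
    unfolding Fit_def using ideal_subset by (intro generate_is_subgroup) blast
  have NF: "N \<subseteq> Fit A M"
  proof
    fix x assume "x \<in> N"
    then have "x \<in> \<Union>{I. brace_ideal A M I \<and> B_centrally_nilpotent A M I}" using iN N(1) by blast
    then show "x \<in> Fit A M" unfolding Fit_def by (rule generate.incl)
  qed
  obtain k :: nat where "card (carrier (A Mod N)) = 2 ^ k" using two_steps_card [OF N(2) iN refl] by blast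
  \<comment> \<open>A divisor of 2^k is non-zero, so this also excludes the value 0 that
    \<open>card\<close> takes on an infinite set of cosets.\<close>
  then have "card (rcosets\<^bsub>A\<^esub> Fit A M) dvd 2 ^ k"
    using card_rcosets_quotient [OF iN F NF] by (metis dvd_triv_left)
  then show ?thesis by (auto simp: FactGroup_def divides_primepow_nat)
qed

end
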